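(* Let $(S_n)$ be the multidimensional elephant random walk with stops on $\mathbb{Z}^d$ with parameters $p,q\in[0,1]$, $r\in(0,1)$, $p+(2d-1)q+r=1$, in the diffusive regime $p<p_{d,r}$, where $p_{d,r}=\left(\frac{2d+1}{4d}\right)(1-r)$. Then $$\lim_{n\to\infty}\frac1n S_n=0\quad\text{almost surely.}$$ More precisely, $$\frac{\|S_n\|^2}{n^2}=O\left(\frac{\log n}{n^{1+r}}\right)\quad\text{almost surely.}$$
   Context: Multidimensional elephant random walk with stops (MERWS). Let $d\ge1$ be an integer and $p,q\in[0,1]$, $r\in(0,1)$ with $p+(2d-1)q+r=1$. Let $I_d$ be the $d\times d$ identity matrix and $J_d$ the $d\times d$ cyclic permutation matrix with $(J_d)_{i,i+1}=1$ for $1\le i\le d-1$, $(J_d)_{d,1}=1$, and all other entries $0$. Let $(e_1,\dots,e_d)$ be the standard basis of $\mathbb{R}^d$. Set $S_0=0$, let $X_1$ be uniformly distributed on the $2d$ vectors $\pm e_1,\dots,\pm e_d$, and $S_1=X_1$. For all $n\ge1$, $X_{n+1}=A_{n+1}X_{U_{n+1}}$ and $S_{n+1}=S_n+X_{n+1}$, where $U_{n+1}$ is uniformly distributed on $\{1,\dots,n\}$ and $A_{n+1}$ is a random matrix equal to $I_d$ with probability $p$, to $-I_d$ with probability $q$, to each of $J_d^i$ and $-J_d^i$ ($1\le i\le d-1$) with probability $q$, and to the zero matrix with probability $r$; $A_{n+1}$ and $U_{n+1}$ are independent of each other and of $\mathcal{F}_n=\sigma(X_1,\dots,X_n)$. $\|\cdot\|$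 is the Euclidean norm. "$Y_n=O(c_n)$ almost surely" means that, almost surely, $|Y_n|/c_n$ is bounded for $n$ large (by a possibly random finite constant). *)

theory Defs
  imports "HOL-Probability.Probability" "HOL-Library.Landau_Symbols"
begin

text \<open>
  The dimension is \<open>d = CARD('n)\<close>. The linear order on the index type plays the role of the
  order on \<open>{1,\<dots>,d}\<close>, which is only needed to say what the cyclic permutation matrix is: its
  row \<open>i\<close> has its single entry 1 in column \<open>i + 1\<close>, and the last row has it in the first column.
\<close>

definition cyclic_succ :: "'n \<Rightarrow> 'n::{finite,linorder}" where
  "cyclic_succ i = (if i = Max UNIV then Min UNIV else Min {j. i < j})"

definition cyclic_matrix :: "real^'n::{finite,linorder}^'n::_" where
  "cyclic_matrix = (\<chi> i j. if j = cyclic_succ i then 1 else 0)"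

text \<open>The product \<open>*\<close>, hence also \<open>^\<close>, on \<open>real^'n^'n\<close> is entrywise, so powers with respect to
  the matrix product are introduced separately.\<close>

primrec matrix_power :: "real^'n^'n \<Rightarrow> nat \<Rightarrow> real^'n^'n" where
  "matrix_power B 0 = mat 1"
| "matrix_power B (Suc k) = B ** matrix_power B k"

definition vimage_sets :: "'a measure \<Rightarrow> ('a \<Rightarrow> 'b) \<Rightarrow> 'b measure \<Rightarrow> 'a set set" where
  "vimage_sets M Y N = {Y -` B \<inter> space M |B. B \<in> sets N}"

definition history_sets :: "'a measure \<Rightarrow> (nat \<Rightarrow> 'a \<Rightarrow> 'b::topological_space) \<Rightarrow> nat \<Rightarrow> 'a set set" where
  "history_sets M X n = sigma_sets (space M) (\<Union>k\<in>{1..n}. vimage_sets M (X k) borel)"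

definition merws_threshold :: "nat \<Rightarrow> real \<Rightarrow> real" where
  "merws_threshold d r = (2 * real d + 1) / (4 * real d) * (1 - r)"

text \<open>
  Only \<open>X n\<close> for \<open>n \<ge> 1\<close> and \<open>A n\<close>, \<open>U n\<close> for \<open>n \<ge> 2\<close> are meaningful.
  The assumption \<open>indep\<close> is mutual independence of the three sigma-algebras generated by
  \<open>A (n + 1)\<close>, by \<open>U (n + 1)\<close> and by \<open>X 1, \<dots>, X n\<close>.
\<close>

locale merws = prob_space M for M :: "'a measure" +
  fixes p q r :: real
    and A :: "nat \<Rightarrow> 'a \<Rightarrow> real^'n::{finite,linorder}^'n::_"
    and U :: "nat \<Rightarrow> 'a \<Rightarrow> nat"
    and X S :: "nat \<Rightarrow> 'a \<Rightarrow> real^'n::_"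
  assumes p_range: "p \<in> {0..1}"
    and q_range: "q \<in> {0..1}"
    and r_range: "r \<in> {0<..<1}"
    and total: "p + (2 * real CARD('n) - 1) * q + r = 1"
    and X_rv: "\<And>n. n \<ge> 1 \<Longrightarrow> random_variable borel (X n)"
    and A_rv: "\<And>n. n \<ge> 1 \<Longrightarrow> random_variable borel (A (n + 1))"
    and U_rv: "\<And>n. n \<ge> 1 \<Longrightarrow> random_variable (count_space UNIV) (U (n + 1))"
    and X1_uniform: "\<And>v. v \<in> (\<Union>i. {axis i 1, - axis i 1}) \<Longrightarrow>
      prob {\<omega> \<in> space M. X 1 \<omega> = v} = 1 / (2 * real CARD('n))"
    and U_uniform: "\<And>n k. n \<ge> 1 \<Longrightarrow> k \<in> {1..n} \<Longrightarrow>
      prob {\<omega> \<in> space M. U (n + 1) \<omega> = k} = 1 / real n"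
    and A_id: "\<And>n. n \<ge> 1 \<Longrightarrow> prob {\<omega> \<in> space M. A (n + 1) \<omega> = mat 1} = p"
    and A_neg_id: "\<And>n. n \<ge> 1 \<Longrightarrow> prob {\<omega> \<in> space M. A (n + 1) \<omega> = - mat 1} = q"
    and A_cyclic: "\<And>n i. n \<ge> 1 \<Longrightarrow> i \<in> {1..CARD('n) - 1} \<Longrightarrow>
      prob {\<omega> \<in> space M. A (n + 1) \<omega> = matrix_power cyclic_matrix i} = q"
    and A_neg_cyclic: "\<And>n i. n \<ge> 1 \<Longrightarrow> i \<in> {1..CARD('n) - 1} \<Longrightarrow>
      prob {\<omega> \<in> space M. A (n + 1) \<omega> = - matrix_power cyclic_matrix i} = q"
    and A_zero: "\<And>n. n \<ge> 1 \<Longrightarrow> prob {\<omega> \<in> space M. A (n + 1) \<omega> = 0} = r"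
    and indep: "\<And>n. n \<ge> 1 \<Longrightarrow>
      indep_sets (case_option (history_sets M X n)
        (case_bool (vimage_sets M (A (n + 1)) borel)
                   (vimage_sets M (U (n + 1)) (count_space UNIV)))) UNIV"
    and X_step: "\<And>n \<omega>. n \<ge> 1 \<Longrightarrow> \<omega> \<in> space M \<Longrightarrow>
      X (n + 1) \<omega> = A (n + 1) \<omega> *v X (U (n + 1) \<omega>) \<omega>"
    and S_0: "\<And>\<omega>. \<omega> \<in> space M \<Longrightarrow> S 0 \<omega> = 0"
    and S_1: "\<And>\<omega>. \<omega> \<in> space M \<Longrightarrow> S 1 \<omega> = X 1 \<omega>"
    and S_step: "\<And>n \<omega>. n \<ge> 1 \<Longrightarrow> \<omega> \<in> space M \<Longrightarrow> S (n + 1) \<omega> = S n \<omega> + X (n + 1) \<omega>"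

end

theory Submission
  imports Defs "HOL-Real_Asymp.Real_Asymp"
begin

text \<open>
  Write \<open>a = p - q\<close>. The contributions of \<open>J^i\<close> and \<open>- J^i\<close> to the mean of a step cancel
  except for the surplus \<open>p - q\<close> of the identity, so given the past the next step has mean
  \<open>a S\<^sub>n / n\<close>, and the diffusive condition says exactly \<open>2 a < 1 - r\<close>. Every nonzero matrix among the
  values of \<open>A\<close> is an isometry, so given the past the next step has squared length of mean
  \<open>(1 - r) N\<^sub>n / n\<close>, where \<open>N\<^sub>n\<close> counts the nonzero steps so far. The products
  \<open>growth z n = \<Prod>j<n. (1 + z / j)\<close>, which are comparable to \<open>n powr z\<close>, turn both facts into
  martingales.

  The size of the fluctuations is set by \<open>N\<^sub>n\<close>: the process \<open>N\<^sub>n / growth (1 - r) n\<close> is a nonnegative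
  martingale, so by the maximal inequality it is almost surely bounded (\<open>AE_num_moves_bounded\<close>), and
  \<open>N\<^sub>n\<close> is of order at most \<open>n powr (1 - r)\<close>. The constant in this bound is random, so the deviation
  estimate keeps \<open>N\<^sub>n\<close> itself in its compensator.

  That estimate is exponential. For a unit vector \<open>w\<close> and a small \<open>\<mu>\<close> put \<open>\<theta>\<^sub>k = (\<mu> / growth a k) w\<close>.
  Then the exponential of \<open>\<theta>\<^sub>n \<bullet> S\<^sub>n - (\<Sum>k<n. \<bar>\<theta>\<^bsub>k+1\<^esub>\<bar>\<^sup>2 N\<^sub>k / k)\<close> is a supermartingale
  (\<open>exp_position_supermartingale\<close>). Markov's inequality at level \<open>m\<^sup>2\<close> gives probabilities that are
  summable in \<open>m\<close>, even though \<open>\<mu>\<close> is chosen anew for every \<open>m\<close>, and the Borel-Cantelli lemma makes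
  \<open>\<theta>\<^sub>m \<bullet> S\<^sub>m\<close> eventually smaller than \<open>2 ln m\<close> plus the compensator. If \<open>N\<^sub>k \<le> K growth (1 - r) k\<close>, the
  compensator is at most a multiple of \<open>\<mu>\<^sup>2 m powr (1 - r - 2 a)\<close>; here \<open>2 a < 1 - r\<close> makes the
  sum \<open>\<Sum>k<m. k powr (- r - 2 a)\<close> grow like \<open>m powr (1 - r - 2 a)\<close> (\<open>variation_bound\<close>).
  The choice \<open>\<mu>\<^sup>2 = ln m / m powr (1 - r - 2 a)\<close> balances both terms and yields
  \<open>w \<bullet> S\<^sub>m = O(sqrt (ln m) m powr ((1 - r) / 2))\<close>. Applying this to the vectors \<open>\<plusminus>e\<^sub>i\<close> bounds the norm,
  and the law of large numbers is a consequence of the rate.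
\<close>

section \<open>The products that describe linear reinforcement\<close>

text \<open>
  This is \<open>\<Gamma>(n + z) / (\<Gamma>(1 + z) \<Gamma>(n))\<close>: the factor by which a quantity grows up to time \<open>n\<close> if its
  mean increment at time \<open>j\<close> is \<open>z / j\<close> times its current value.
\<close>
definition growth :: "real \<Rightarrow> nat \<Rightarrow> real" where
  "growth z n = (\<Prod>j=1..<n. 1 + z / real j)"

lemma growth_1 [simp]: "growth z (Suc 0) = 1"
  by (simp add: growth_def)

lemma growth_Suc: "n \<ge> 1 \<Longrightarrow> growth z (Suc n) = growth z n * (1 + z / real n)"
  by (simp add: growth_def)

lemma growth_pos:
  assumes "z > -1"
  shows "growth z n > 0"
  unfolding growth_def
proof (rule prod_pos)
  fix j assume "j \<in> {1..<n}"
  then have "real j + z > 0" using assms by auto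
  then show "0 < 1 + z / real j" using \<open>j \<in> {1..<n}\<close> by (simp add: field_simps)
qed

lemma growth_eq_pochhammer: "growth z (Suc n) = pochhammer (1 + z) n / fact n"
proof (induction n)
  case (Suc n)
  have "growth z (Suc (Suc n)) = growth z (Suc n) * (1 + z / real (Suc n))"
    by (rule growth_Suc) simp
  also have "\<dots> = pochhammer (1 + z) n / fact n * ((1 + z + real n) / real (Suc n))"
  proof -
    have "1 + z / real (Suc n) = (1 + z + real n) / real (Suc n)"
      by (simp add: field_simps)
    then show ?thesis by (simp only: Suc)
  qed
  also have "\<dots> = pochhammer (1 + z) (Suc n) / fact (Suc n)"
    by (simp add: pochhammer_Suc)
  finally show ?case .
qed simp

text \<open>
  Up to elementary factors tending to 1 the quotient is Euler's approximation of \<open>rGamma (1 + z)\<close>.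
\<close>
lemma growth_ratio_limit:
  assumes "z > -1"
  shows "(\<lambda>n. growth z n / real n powr z) \<longlonglongrightarrow> rGamma (1 + z)"
proof -
  have "(\<lambda>n. rGamma_series (1 + z) n * (real n powr (1 + z) / (real (n+1) * real (n+2) powr z)))
          \<longlonglongrightarrow> rGamma (1 + z) * 1"
  proof (rule tendsto_mult[OF rGamma_series_LIMSEQ])
    show "(\<lambda>n. real n powr (1 + z) / (real (n+1) * real (n+2) powr z)) \<longlonglongrightarrow> 1"
      by real_asymp
  qed
  moreover have "\<forall>\<^sub>F n in sequentially. rGamma_series (1 + z) n * (real n powr (1 + z) / (real (n+1) * real (n+2) powr z))
      = growth z (n + 2) / real (n + 2) powr z"
    using eventually_gt_at_top[of 0]
  proof eventually_elim
    case (elim n)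
    have "growth z (n + 2) = pochhammer (1 + z) (n + 1) / (fact n * real (n + 1))"
      using growth_eq_pochhammer[of z "n + 1"] by (simp add: mult.commute)
    then show ?case
      using elim by (simp add: rGamma_series_def powr_def)
  qed
  ultimately have "(\<lambda>n. growth z (n + 2) / real (n + 2) powr z) \<longlonglongrightarrow> rGamma (1 + z)"
    unfolding mult_1_right by (rule Lim_transform_eventually)
  then show ?thesis by (rule LIMSEQ_offset)
qed

text \<open>
  The quotient of \<open>growth z n\<close> and \<open>n powr z\<close> is positive and has a positive limit, so it is bounded away from 0 and
  from infinity over all \<open>n \<ge> 1\<close>, with no exceptional small indices.
\<close>
lemma growth_powr_bounds:
  assumes "z > -1"
  obtains c C where "c > 0" "C > 0"
    "\<And>n. n \<ge> 1 \<Longrightarrow> c * real n powr z \<le> growth z n"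
    "\<And>n. n \<ge> 1 \<Longrightarrow> growth z n \<le> C * real n powr z"
proof -
  define R where "R n = growth z n / real n powr z" for n
  have lim: "R \<longlonglongrightarrow> rGamma (1 + z)"
    unfolding R_def by (rule growth_ratio_limit[OF assms])
  have lpos: "rGamma (1 + z) \<noteq> 0"
    using assms by (simp add: rGamma_inverse_Gamma Gamma_real_pos less_imp_neq[symmetric])
  have Rpos: "R n > 0" if "n \<ge> 1" for n
    using growth_pos[OF assms] that by (simp add: R_def)
  obtain C where C: "C > 0" "\<And>n. norm (R n) \<le> C"
    using lim convergentI convergent_imp_Bseq BseqE by metis
  obtain D where D: "D > 0" "\<And>n. norm (inverse (R n)) \<le> D"
    using tendsto_inverse[OF lim lpos] convergentI convergent_imp_Bseq BseqE by metis
  show thesis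
  proof (rule that[of "1 / D" C])
    fix n :: nat assume n: "n \<ge> 1"
    show "growth z n \<le> C * real n powr z"
      using C(2)[of n] n by (simp add: R_def field_simps abs_le_iff)
    have "1 / D \<le> R n"
      using D(2)[of n] D(1) Rpos[OF n] by (simp add: field_simps)
    then show "1 / D * real n powr z \<le> growth z n"
      using n by (simp add: R_def field_simps)
  qed (use C D in auto)
qed

text \<open>
  Up to constants \<open>k powr (s - 1)\<close> is \<open>s * growth s k / k\<close>, the increment of \<open>growth s\<close> at \<open>k\<close>, so
  the sum telescopes.
\<close>
lemma sum_powr_le:
  assumes "s > 0"
  obtains C where "C > 0" "\<And>m. m \<ge> 1 \<Longrightarrow> (\<Sum>k=1..<m. real k powr (s - 1)) \<le> C * real m powr s"
proof -
  obtain c C where b: "c > 0" "C > 0"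
    "\<And>n. n \<ge> 1 \<Longrightarrow> c * real n powr s \<le> growth s n"
    "\<And>n. n \<ge> 1 \<Longrightarrow> growth s n \<le> C * real n powr s"
    using growth_powr_bounds[of s] assms by (metis less_trans neg_less_0_iff_less zero_less_one)
  have tel: "(\<Sum>k=1..<m. s * growth s k / real k) = growth s m - 1" if "m \<ge> 1" for m
    using that by (induction m rule: dec_induct) (auto simp: growth_Suc algebra_simps)
  have "(\<Sum>k=1..<m. real k powr (s - 1)) \<le> C / (c * s) * real m powr s" if m: "m \<ge> 1" for m
  proof -
    have "(\<Sum>k=1..<m. real k powr (s - 1)) \<le> (\<Sum>k=1..<m. s * growth s k / real k / (c * s))"
    proof (rule sum_mono)
      fix k assume "k \<in> {1..<m}"
      then have k: "k \<ge> 1" by simp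
      have "real k powr (s - 1) = real k powr s / real k"
        using k by (simp add: powr_diff)
      then show "real k powr (s - 1) \<le> s * growth s k / real k / (c * s)"
        using b(3)[OF k] b(1) k assms by (simp add: field_simps)
    qed
    also have "\<dots> = (growth s m - 1) / (c * s)"
      using tel[OF m] by (simp only: sum_divide_distrib[symmetric])
    also have "\<dots> \<le> C * real m powr s / (c * s)"
      using b(4)[OF m] b(1) assms by (intro divide_right_mono) auto
    finally show ?thesis by simp
  qed
  then show thesis
    using that[of "C / (c * s)"] b assms by simp
qed

lemma exp_le_quadratic:
  fixes x :: real
  assumes "\<bar>x\<bar> \<le> 1"
  shows "exp x \<le> 1 + x + x\<^sup>2"
proof (cases "x \<ge> 0")
  case True
  then show ?thesis using assms exp_bound by simp
next
  case False
  define y where "y = - x"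
  have y: "y > 0" using False by (simp add: y_def)
  \<comment> \<open>For negative arguments the claim follows from the tangent bound for \<open>exp y\<close>, since
    \<open>(1 - y + y\<^sup>2) (1 + y) = 1 + y\<^sup>3\<close>.\<close>
  have "1 \<le> 1 + y ^ 3" using y by simp
  also have "\<dots> = (1 - y + y\<^sup>2) * (1 + y)"
    by (simp add: algebra_simps power2_eq_square power3_eq_cube)
  also have "\<dots> \<le> (1 - y + y\<^sup>2) * exp y"
    using y by (intro mult_left_mono exp_ge_add_one_self) 
       (use zero_le_power2[of "y - 1/2"] in \<open>simp add: power2_diff power_divide\<close>)
  finally have "1 / exp y \<le> 1 - y + y\<^sup>2"
    by (simp add: field_simps)
  then show ?thesis by (simp add: y_def exp_minus inverse_eq_divide)
qed

lemma sqrt_ln_powr_tendsto_0: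
  assumes "e > 0"
  shows "(\<lambda>m. sqrt (ln (real m)) * real m powr (- e)) \<longlonglongrightarrow> 0"
  using assms by real_asymp

lemma ln_over_powr_tendsto_0:
  assumes "e > 0"
  shows "(\<lambda>m. ln (real m) / real m powr e) \<longlonglongrightarrow> 0"
  using assms by real_asymp

section \<open>Powers of the cyclic permutation matrix\<close>

definition order_rank :: "'n::{finite,linorder} \<Rightarrow> nat" where
  "order_rank k = card {j. j < k}"

lemma order_rank_strict_mono: "j < k \<Longrightarrow> order_rank j < order_rank k"
  unfolding order_rank_def by (rule psubset_card_mono) auto

lemma inj_order_rank: "inj order_rank"
  by (rule injI) (metis linorder_neqE order_rank_strict_mono less_irrefl)

lemma order_rank_Min: "order_rank (Min UNIV :: 'n::{finite,linorder}) = 0"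
  by (simp add: order_rank_def leD)

lemma order_rank_Max: "order_rank (Max UNIV :: 'n::{finite,linorder}) = CARD('n) - 1"
proof -
  have "{j. j < (Max UNIV :: 'n)} = UNIV - {Max UNIV}"
    by (auto simp: less_le)
  then show ?thesis by (simp add: order_rank_def card_Diff_singleton)
qed

text \<open>
  In terms of ranks the cyclic successor is addition of 1 modulo the cardinality. This yields both
  that it is a permutation and that its powers below the cardinality differ.
\<close>
lemma order_rank_cyclic_succ:
  fixes k :: "'n::{finite,linorder}"
  assumes "k \<noteq> Max UNIV"
  shows "order_rank (cyclic_succ k) = Suc (order_rank k)"
proof -
  have "k < Max UNIV" using assms by (simp add: less_le)
  then have ne: "{j. k < j} \<noteq> {}" by auto
  define l where "l = Min {j. k < j}"
  have l: "k < l" using Min_in[OF _ ne] by (auto simp: l_def)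
  have "{j. j < l} = insert k {j. j < k}"
  proof (rule set_eqI)
    fix j
    have "k < j \<Longrightarrow> l \<le> j" unfolding l_def by (rule Min_le) auto
    then show "j \<in> {j. j < l} \<longleftrightarrow> j \<in> insert k {j. j < k}"
      using l by (cases "k < j"; cases "j = k") (auto simp: not_less)
  qed
  then show ?thesis
    using assms by (simp add: order_rank_def cyclic_succ_def l_def)
qed

lemma inj_cyclic_succ: "inj (cyclic_succ :: 'n \<Rightarrow> 'n::{finite,linorder})"
proof (rule injI)
  fix j k :: 'n
  assume eq: "cyclic_succ j = cyclic_succ k"
  have 0: "order_rank (cyclic_succ (Max UNIV) :: 'n) = 0"
    by (simp add: cyclic_succ_def order_rank_Min)
  have "order_rank j = order_rank k" if "j \<noteq> Max UNIV" "k \<noteq> Max UNIV"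
    using order_rank_cyclic_succ[OF that(1)] order_rank_cyclic_succ[OF that(2)] eq by simp
  then show "j = k"
    using eq 0 order_rank_cyclic_succ[of j] order_rank_cyclic_succ[of k] inj_order_rank
    by (metis injD nat.distinct(1))
qed

lemma order_rank_funpow_cyclic_succ:
  "i < CARD('n) \<Longrightarrow> order_rank ((cyclic_succ ^^ i) (Min UNIV :: 'n::{finite,linorder})) = i"
proof (induction i)
  case (Suc i)
  then have "(cyclic_succ ^^ i) (Min UNIV :: 'n) \<noteq> Max UNIV"
    using order_rank_Max[where 'n='n] by auto
  then show ?case using Suc by (simp add: order_rank_cyclic_succ)
qed (simp add: order_rank_Min)

lemma cyclic_matrix_mult: "(cyclic_matrix *v v) $ k = v $ cyclic_succ k"
  by (simp add: cyclic_matrix_def matrix_vector_mult_def if_distrib[of "\<lambda>x. x * _"] cong: if_cong)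

lemma matrix_power_cyclic_mult:
  "(matrix_power cyclic_matrix i *v v) $ k = v $ (cyclic_succ ^^ i) k"
  by (induction i arbitrary: k)
     (simp_all add: matrix_vector_mul_assoc[symmetric] cyclic_matrix_mult funpow_swap1)

lemma norm_matrix_power_cyclic_mult [simp]:
  "norm (matrix_power cyclic_matrix i *v v) = norm v"
proof -
  have "bij (cyclic_succ ^^ i :: 'a \<Rightarrow> 'a)"
    by (simp add: bij_def finite_UNIV_inj_surj inj_fn inj_cyclic_succ)
  then have "(\<Sum>k\<in>UNIV. (v $ (cyclic_succ ^^ i) k)\<^sup>2) = (\<Sum>k\<in>UNIV. (v $ k)\<^sup>2)"
    by (intro sum.reindex_bij_betw)
  then show ?thesis
    by (simp add: norm_vec_def L2_set_def matrix_power_cyclic_mult)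
qed

text \<open>
  Distinctness makes the probabilities in the law of \<open>A\<close> those of disjoint events; as they add up
  to 1, almost surely \<open>A\<close> takes no other value.
\<close>
lemma matrix_power_cyclic_distinct:
  fixes s t :: real
  assumes "i < CARD('n::{finite,linorder})" "j < CARD('n)" "s \<in> {1, -1}" "t \<in> {1, -1}"
    and "s *\<^sub>R (matrix_power cyclic_matrix i :: real^'n::{finite,linorder}^'n::_) = t *\<^sub>R matrix_power cyclic_matrix j"
  shows "s = t \<and> i = j"
proof -
  \<comment> \<open>The image of \<open>v\<close> under \<open>s J^i\<close> has first coordinate \<open>s (i + 1)\<close>, which determines \<open>s\<close> and \<open>i\<close>.\<close>
  define v :: "real^'n::_" where "v = (\<chi> k. real (Suc (order_rank k)))"
  have "((s *\<^sub>R matrix_power cyclic_matrix i) *v v) $ Min UNIV = ((t *\<^sub>R matrix_power cyclic_matrix j) *v v) $ Min UNIV"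
    using assms(5) by simp
  then have "s * real (Suc i) = t * real (Suc j)"
    using assms(1,2) by (simp add: scaleR_matrix_vector_assoc[symmetric] matrix_power_cyclic_mult v_def order_rank_funpow_cyclic_succ)
  then show ?thesis using assms(3,4) by auto
qed

lemma matrix_power_cyclic_nonzero: "matrix_power cyclic_matrix i \<noteq> (0 :: real^'n::{finite,linorder}^'n::_)"
proof
  assume *: "matrix_power cyclic_matrix i = (0 :: real^'n::_^'n::_)"
  have "norm (axis (Min UNIV) 1 :: real^'n::{finite,linorder}) = 0"
    by (subst norm_matrix_power_cyclic_mult[of i, symmetric]) (simp add: *)
  then show False by simp
qed

section \<open>The law of one step\<close>

lemma (in prob_space) AE_in_finite_set:
  assumes "finite T" "\<And>v. v \<in> T \<Longrightarrow> {\<omega> \<in> space M. Y \<omega> = v} \<in> events"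
    and "(\<Sum>v\<in>T. prob {\<omega> \<in> space M. Y \<omega> = v}) = 1"
  shows "AE \<omega> in M. Y \<omega> \<in> T"
proof -
  have "prob (\<Union>v\<in>T. {\<omega> \<in> space M. Y \<omega> = v}) = 1"
    using assms by (subst finite_measure_finite_Union) (auto simp: disjoint_family_on_def)
  then have "AE \<omega> in M. \<omega> \<in> (\<Union>v\<in>T. {\<omega> \<in> space M. Y \<omega> = v})"
    by (rule AE_prob_1)
  then show ?thesis by eventually_elim auto
qed

text \<open>
  Since \<open>matrix_power cyclic_matrix 0 = mat 1\<close>, the identity and its negative are the terms with
  \<open>i = 0\<close>.
\<close>
definition step_matrices :: "(real^'n::{finite,linorder}^'n::_) set" where
  "step_matrices = insert 0 (matrix_power cyclic_matrix ` {..<CARD('n)} \<union>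
     (\<lambda>i. - matrix_power cyclic_matrix i) ` {..<CARD('n)})"

lemma finite_step_matrices [simp]: "finite step_matrices"
  by (simp add: step_matrices_def)

lemma sum_step_matrices:
  fixes f :: "real^'n::{finite,linorder}^'n::_ \<Rightarrow> real"
  shows "(\<Sum>B\<in>step_matrices. f B) = f 0 +
    (\<Sum>i<CARD('n). f (matrix_power cyclic_matrix i) + f (- matrix_power cyclic_matrix i))"
proof -
  let ?J = "matrix_power cyclic_matrix :: nat \<Rightarrow> real^'n::{finite,linorder}^'n::_"
  let ?P = "?J ` {..<CARD('n)}" and ?N = "(\<lambda>i. - ?J i) ` {..<CARD('n)}"
  have dist: "?J i \<noteq> - ?J j" if "i < CARD('n)" "j < CARD('n)" for i j
    using matrix_power_cyclic_distinct[OF that, of 1 "-1"] by auto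
  have inj: "inj_on ?J {..<CARD('n)}"
    using matrix_power_cyclic_distinct[of _ _ 1 1, where 'n='n] by (auto intro!: inj_onI)
  have "0 \<notin> ?P \<union> ?N" using matrix_power_cyclic_nonzero by (auto dest: sym)
  then have "(\<Sum>B\<in>step_matrices. f B) = f 0 + (\<Sum>B\<in>?P \<union> ?N. f B)"
    by (simp add: step_matrices_def)
  also have "(\<Sum>B\<in>?P \<union> ?N. f B) = (\<Sum>B\<in>?P. f B) + (\<Sum>B\<in>?N. f B)"
    using dist by (intro sum.union_disjoint) auto
  also have "\<dots> = (\<Sum>i<CARD('n). f (?J i) + f (- ?J i))"
    using inj by (simp add: sum.reindex inj_on_def sum.distrib)
  finally show ?thesis .
qed

lemma uminus_matrix_vector_mult: "(- B) *v v = - (B *v (v :: real^'n))"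
  by (simp add: matrix_vector_mult_def vec_eq_iff sum_negf)

lemma norm_step_matrix_mult_le: "B \<in> step_matrices \<Longrightarrow> norm (B *v v) \<le> norm v"
  by (auto simp: step_matrices_def uminus_matrix_vector_mult)

context merws
begin

abbreviation drift :: real where "drift \<equiv> p - q"

definition step_weight :: "real^'n::{finite,linorder}^'n::_ \<Rightarrow> real" where
  "step_weight B = (if B = 0 then r else if B = mat 1 then p else q)"

lemma step_weight_nonneg: "step_weight B \<ge> 0"
  using p_range q_range r_range by (simp add: step_weight_def)

text \<open>
  Each signed power has weight \<open>q\<close>, except that the identity has the additional weight \<open>p - q\<close>.
  In this form the moments of a step can be read off: odd functions see only the additional weight.
\<close>
lemma sum_step_weight:
  fixes f :: "real^'n::{finite,linorder}^'n::_ \<Rightarrow> real"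
  shows "(\<Sum>B\<in>step_matrices. step_weight B * f B) = r * f 0 + drift * f (mat 1) +
    q * (\<Sum>i<CARD('n). f (matrix_power cyclic_matrix i) + f (- matrix_power cyclic_matrix i))"
proof -
  let ?J = "matrix_power cyclic_matrix :: nat \<Rightarrow> real^'n::{finite,linorder}^'n::_"
  have pos: "step_weight (?J i) = (if i = 0 then drift else 0) + q" if "i < CARD('n)" for i
    using matrix_power_cyclic_distinct[OF that, of 0 1 1] matrix_power_cyclic_nonzero[of i, where 'n='n]
    by (auto simp: step_weight_def)
  have neg: "step_weight (- ?J i) = q" if "i < CARD('n)" for i
    using matrix_power_cyclic_distinct[OF that, of 0 "-1" 1] matrix_power_cyclic_nonzero[of i, where 'n='n]
    by (auto simp: step_weight_def)
  have "(\<Sum>i<CARD('n). step_weight (?J i) * f (?J i) + step_weight (- ?J i) * f (- ?J i)) =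
      (\<Sum>i<CARD('n). (if i = 0 then drift * f (?J i) else 0) + q * (f (?J i) + f (- ?J i)))"
    by (intro sum.cong refl) (simp add: pos neg algebra_simps)
  also have "\<dots> = drift * f (mat 1) + q * (\<Sum>i<CARD('n). f (?J i) + f (- ?J i))"
    by (simp only: sum.distrib sum_distrib_left[symmetric]) (simp add: sum.delta)
  finally show ?thesis
    by (simp add: sum_step_matrices step_weight_def)
qed

lemma sum_step_weight_1: "(\<Sum>B\<in>(step_matrices :: (real^'n::{finite,linorder}^'n::_) set). step_weight B) = 1"
  using sum_step_weight[of "\<lambda>_. 1"] total by (simp add: algebra_simps)

text \<open>
  This will be the mean of \<open>\<phi> (X (n + 1))\<close> given the past and given that the remembered step is \<open>v\<close>.
\<close>
definition mean_step :: "(real^'n::{finite,linorder} \<Rightarrow> real) \<Rightarrow> real^'n::_ \<Rightarrow> real" where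
  "mean_step \<phi> v = (\<Sum>B\<in>step_matrices. step_weight B * \<phi> (B *v v))"

lemma mean_step_norm_sq: "mean_step (\<lambda>x. (norm x)\<^sup>2) v = (1 - r) * (norm v)\<^sup>2"
proof -
  have "mean_step (\<lambda>x. (norm x)\<^sup>2) v = (p + (2 * real CARD('n) - 1) * q) * (norm v)\<^sup>2"
    by (simp add: mean_step_def sum_step_weight uminus_matrix_vector_mult algebra_simps)
  also have "p + (2 * real CARD('n) - 1) * q = 1 - r" using total by simp
  finally show ?thesis .
qed

lemma mean_step_inner: "mean_step (\<lambda>x. \<theta> \<bullet> x) v = drift * (\<theta> \<bullet> v)"
  by (simp add: mean_step_def sum_step_weight uminus_matrix_vector_mult)

text \<open>
  The linear term of the quadratic bound averages to the drift, and since the matrices do not increase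
  norms, the quadratic term is at most \<open>(norm \<theta>)\<^sup>2 * (norm v)\<^sup>2\<close>.
\<close>
lemma mean_step_exp_le:
  assumes "norm \<theta> \<le> 1" "norm v \<le> 1"
  shows "mean_step (\<lambda>x. exp (\<theta> \<bullet> x)) v \<le> 1 + drift * (\<theta> \<bullet> v) + (norm \<theta>)\<^sup>2 * (norm v)\<^sup>2"
proof -
  have "exp (\<theta> \<bullet> (B *v v)) \<le> 1 + \<theta> \<bullet> (B *v v) + (norm \<theta>)\<^sup>2 * (norm v)\<^sup>2"
    if B: "B \<in> step_matrices" for B
  proof -
    have "\<bar>\<theta> \<bullet> (B *v v)\<bar> \<le> norm \<theta> * norm (B *v v)"
      by (rule Cauchy_Schwarz_ineq2)
    also have le: "\<dots> \<le> norm \<theta> * norm v"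
      by (intro mult_left_mono norm_step_matrix_mult_le B) simp
    finally have *: "\<bar>\<theta> \<bullet> (B *v v)\<bar> \<le> norm \<theta> * norm v" .
    also have "\<dots> \<le> 1" using assms by (simp add: mult_le_one)
    finally have "exp (\<theta> \<bullet> (B *v v)) \<le> 1 + \<theta> \<bullet> (B *v v) + (\<theta> \<bullet> (B *v v))\<^sup>2"
      by (rule exp_le_quadratic)
    moreover have "(\<theta> \<bullet> (B *v v))\<^sup>2 \<le> (norm \<theta> * norm v)\<^sup>2"
      using power_mono[OF *, of 2] by simp
    ultimately show ?thesis by (simp add: power_mult_distrib)
  qed
  then have "mean_step (\<lambda>x. exp (\<theta> \<bullet> x)) v \<le>
      (\<Sum>B\<in>step_matrices. step_weight B * (1 + \<theta> \<bullet> (B *v v) + (norm \<theta>)\<^sup>2 * (norm v)\<^sup>2))"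
    unfolding mean_step_def by (intro sum_mono mult_left_mono step_weight_nonneg)
  also have "\<dots> = (\<Sum>B\<in>step_matrices. step_weight B) * (1 + (norm \<theta>)\<^sup>2 * (norm v)\<^sup>2) + mean_step (\<lambda>x. \<theta> \<bullet> x) v"
    unfolding mean_step_def sum_distrib_right sum.distrib[symmetric]
    by (intro sum.cong refl) (simp add: algebra_simps)
  finally show ?thesis
    by (simp add: sum_step_weight_1 mean_step_inner)
qed

text \<open>
  The sigma-algebra \<open>history_sets M X n\<close> packaged as a measure space, so that functions of the
  past can be treated as measurable functions on it.
\<close>
definition past :: "nat \<Rightarrow> 'a measure" where
  "past n = sigma (space M) (\<Union>k\<in>{1..n}. vimage_sets M (X k) borel)"

lemma vimage_sets_subset: "vimage_sets M Y L \<subseteq> Pow (space M)"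
  by (auto simp: vimage_sets_def)

lemma space_past [simp]: "space (past n) = space M"
  unfolding past_def by (rule space_measure_of) (use vimage_sets_subset in blast)

lemma sets_past: "sets (past n) = history_sets M X n"
  unfolding past_def history_sets_def
  by (rule sets_measure_of) (use vimage_sets_subset in blast)

lemma subalgebra_past: "subalgebra M (past n)"
  unfolding subalgebra_def
proof
  have "(\<Union>k\<in>{1..n}. vimage_sets M (X k) borel) \<subseteq> sets M"
    using X_rv by (auto simp: vimage_sets_def)
  then show "sets (past n) \<subseteq> sets M"
    unfolding sets_past history_sets_def by (rule sets.sigma_sets_subset)
qed simp

lemma measurable_past_imp: "f \<in> measurable (past n) L \<Longrightarrow> f \<in> measurable M L"
  by (rule measurable_from_subalg[OF subalgebra_past])

lemma measurable_X_past:
  assumes "1 \<le> k" "k \<le> n"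
  shows "X k \<in> borel_measurable (past n)"
proof (rule measurableI)
  fix B :: "(real^'n::_) set" assume "B \<in> sets borel"
  then have "X k -` B \<inter> space M \<in> (\<Union>k\<in>{1..n}. vimage_sets M (X k) borel)"
    using assms unfolding vimage_sets_def by fastforce
  then show "X k -` B \<inter> space (past n) \<in> sets (past n)"
    by (simp add: sets_past history_sets_def sigma_sets.Basic)
qed simp

text \<open>
  Together with \<open>sum_step_weight_1\<close> this identifies the law of \<open>A\<close> completely.
\<close>
lemma prob_A_eq:
  assumes "n \<ge> 1" "B \<in> step_matrices"
  shows "prob {\<omega> \<in> space M. A (n + 1) \<omega> = B} = step_weight B"
proof -
  let ?J = "matrix_power cyclic_matrix :: nat \<Rightarrow> real^'n::{finite,linorder}^'n::_"
  consider "B = 0" | i where "i < CARD('n)" "B = ?J i" | i where "i < CARD('n)" "B = - ?J i"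
    using assms(2) by (auto simp: step_matrices_def)
  then show ?thesis
  proof cases
    case 1
    then show ?thesis using A_zero[OF assms(1)] by (simp add: step_weight_def)
  next
    case (2 i)
    have "B \<noteq> 0" using 2 matrix_power_cyclic_nonzero by simp
    show ?thesis
    proof (cases "i = 0")
      case True
      then show ?thesis using 2 \<open>B \<noteq> 0\<close> A_id[OF assms(1)] by (simp add: step_weight_def)
    next
      case False
      then have "B \<noteq> mat 1"
        using matrix_power_cyclic_distinct[of i 0 1 1, where 'n='n] 2 by auto
      then show ?thesis
        using 2 \<open>B \<noteq> 0\<close> False A_cyclic[OF assms(1), of i] by (simp add: step_weight_def)
    qed
  next
    case (3 i)
    have "B \<noteq> 0" using 3 matrix_power_cyclic_nonzero[of i] by simp
    moreover have "B \<noteq> mat 1"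
      using matrix_power_cyclic_distinct[of i 0 "-1" 1, where 'n='n] 3 by auto
    ultimately have "step_weight B = q" by (simp add: step_weight_def)
    then show ?thesis
      using 3 A_neg_id[OF assms(1)] A_neg_cyclic[OF assms(1), of i] by (cases "i = 0") simp_all
  qed
qed

lemma A_eq_event: "n \<ge> 1 \<Longrightarrow> {\<omega> \<in> space M. A (n + 1) \<omega> = B} \<in> events"
  using A_rv[of n] by measurable

lemma U_eq_event: "n \<ge> 1 \<Longrightarrow> {\<omega> \<in> space M. U (n + 1) \<omega> = k} \<in> events"
  using U_rv[of n] by measurable

lemma AE_A: "n \<ge> 1 \<Longrightarrow> AE \<omega> in M. A (n + 1) \<omega> \<in> step_matrices"
  by (rule AE_in_finite_set) (simp_all only: finite_step_matrices A_eq_event prob_A_eq sum_step_weight_1 cong: sum.cong)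

lemma AE_U: "n \<ge> 1 \<Longrightarrow> AE \<omega> in M. U (n + 1) \<omega> \<in> {1..n}"
  by (rule AE_in_finite_set) (simp_all only: finite_atLeastAtMost U_eq_event U_uniform cong: sum.cong, simp)

lemma AE_norm_X1: "AE \<omega> in M. norm (X 1 \<omega>) = 1"
proof -
  let ?T = "(\<Union>i. {axis i 1, - axis i 1}) :: (real^'n::_) set"
  have ne: "axis i 1 \<noteq> (- axis j 1 :: real^'n::_)" for i j
  proof
    assume "axis i 1 = (- axis j 1 :: real^'n::_)"
    then have "(axis i 1 :: real^'n::_) $ i = (- axis j 1 :: real^'n::_) $ i" by simp
    then show False by (simp add: axis_def split: if_splits)
  qed
  have "?T = range (\<lambda>i. axis i 1) \<union> range (\<lambda>i. - axis i 1)" by auto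
  also have "card \<dots> = CARD('n) + CARD('n)"
    using ne by (subst card_Un_disjoint) (auto simp: card_image inj_on_def axis_eq_axis)
  finally have card: "card ?T = 2 * CARD('n)" by simp
  have "AE \<omega> in M. X 1 \<omega> \<in> ?T"
  proof (rule AE_in_finite_set)
    show "{\<omega> \<in> space M. X 1 \<omega> = v} \<in> events" for v
      using X_rv[of 1] by measurable
    have "(\<Sum>v\<in>?T. prob {\<omega> \<in> space M. X 1 \<omega> = v}) = (\<Sum>v\<in>?T. 1 / (2 * real CARD('n)))"
      by (intro sum.cong refl X1_uniform)
    also have "\<dots> = 1" unfolding sum_constant card by simp
    finally show "(\<Sum>v\<in>?T. prob {\<omega> \<in> space M. X 1 \<omega> = v}) = 1" .
  qed simp
  then show ?thesis by eventually_elim auto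
qed

text \<open>
  A step is the image of an earlier one under a matrix that does not increase norms.
\<close>
lemma AE_norm_X_le_1: "AE \<omega> in M. \<forall>k\<in>{1..n}. norm (X k \<omega>) \<le> 1"
proof (induction n)
  case (Suc n)
  show ?case
  proof (cases "n = 0")
    case True
    show ?thesis using AE_norm_X1 by eventually_elim (use True in simp)
  next
    case False
    then have n: "n \<ge> 1" by simp
    from Suc AE_A[OF n] AE_U[OF n] AE_space show ?thesis
    proof eventually_elim
      case (elim \<omega>)
      have "norm (X (n + 1) \<omega>) \<le> norm (X (U (n + 1) \<omega>) \<omega>)"
        unfolding X_step[OF n elim(4)] by (rule norm_step_matrix_mult_le[OF elim(2)])
      also have "\<dots> \<le> 1" using elim(1,3) by blast
      finally show ?case using elim(1) by (auto simp: le_Suc_eq)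
    qed
  qed
qed simp

section \<open>Averaging over the next step\<close>

lemma prob_history_A_U:
  assumes "n \<ge> 1" "H \<in> history_sets M X n"
  shows "prob (H \<inter> ({\<omega> \<in> space M. A (n + 1) \<omega> = B} \<inter> {\<omega> \<in> space M. U (n + 1) \<omega> = k})) =
    prob H * (prob {\<omega> \<in> space M. A (n + 1) \<omega> = B} * prob {\<omega> \<in> space M. U (n + 1) \<omega> = k})"
proof -
  define a where "a = {\<omega> \<in> space M. A (n + 1) \<omega> = B}"
  define u where "u = {\<omega> \<in> space M. U (n + 1) \<omega> = k}"
  let ?G = "case_option H (case_bool a u)"
  have eqA: "a = A (n + 1) -` {B} \<inter> space M" unfolding a_def by auto
  have eqU: "u = U (n + 1) -` {k} \<inter> space M" unfolding u_def by auto
  have "a \<in> vimage_sets M (A (n + 1)) borel"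
    unfolding vimage_sets_def mem_Collect_eq eqA by (intro exI[of _ "{B}"]) simp
  moreover have "u \<in> vimage_sets M (U (n + 1)) (count_space UNIV)"
    unfolding vimage_sets_def mem_Collect_eq eqU by (intro exI[of _ "{k}"]) simp
  ultimately have "prob (\<Inter>j\<in>{None, Some True, Some False}. ?G j) =
      (\<Prod>j\<in>{None, Some True, Some False}. prob (?G j))"
    using assms(2) by (intro indep_setsD[OF indep[OF assms(1)]]) simp_all
  then have "prob (H \<inter> (a \<inter> u)) = prob H * (prob a * prob u)" by simp
  then show ?thesis by (simp only: a_def u_def)
qed

text \<open>
  Independence of events is lifted to functions of the past: the indicator of \<open>G\<close> generates only
  the sigma-algebra generated by \<open>G\<close>.
\<close>
lemma expectation_mult_indicator:
  assumes n: "n \<ge> 1" and Y: "Y \<in> borel_measurable (past n)" "integrable M Y"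
    and G: "G = {\<omega> \<in> space M. A (n + 1) \<omega> = B} \<inter> {\<omega> \<in> space M. U (n + 1) \<omega> = k}"
  shows "expectation (\<lambda>\<omega>. Y \<omega> * indicator G \<omega>) = expectation Y *
     (prob {\<omega> \<in> space M. A (n + 1) \<omega> = B} * prob {\<omega> \<in> space M. U (n + 1) \<omega> = k})"
    and "integrable M (\<lambda>\<omega>. Y \<omega> * indicator G \<omega> :: real)"
proof -
  have Gev: "G \<in> events" unfolding G by (intro sets.Int A_eq_event U_eq_event n)
  have prob_G: "prob G = prob {\<omega> \<in> space M. A (n + 1) \<omega> = B} * prob {\<omega> \<in> space M. U (n + 1) \<omega> = k}"
  proof -
    have "space M \<in> history_sets M X n" using sets.top[of "past n"] by (simp only: sets_past space_past)
    moreover have "space M \<inter> G = G" using Gev sets.sets_into_space by blast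
    ultimately show ?thesis
      using prob_history_A_U[OF n, of "space M" B k] by (simp only: G[symmetric] prob_space mult_1_left)
  qed
  have "indep_set (history_sets M X n) {G}"
  proof (rule indep_setI)
    show "history_sets M X n \<subseteq> events" using subalgebra_past[of n] unfolding subalgebra_def sets_past by (rule conjunct2)
    show "prob (a \<inter> b) = prob a * prob b" if "a \<in> history_sets M X n" "b \<in> {G}" for a b
      using prob_history_A_U[OF n that(1), of B k] that(2) by (simp only: G[symmetric] prob_G[symmetric] singleton_iff)
  qed (use Gev in simp)
  then have "indep_set (sigma_sets (space M) (history_sets M X n)) (sigma_sets (space M) {G})"
    by (rule indep_set_sigma_sets)
       (auto simp: Int_stable_def sets_past[symmetric])
  then have ind: "indep_set (sets (past n)) (sigma_sets (space M) {G})"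
    using sets.sigma_sets_eq[of "past n"] by (simp add: sets_past)
  have indep_YG: "indep_var borel Y borel (indicator G :: 'a \<Rightarrow> real)"
    unfolding indep_var_eq
  proof (intro conjI)
    show "random_variable borel Y" using Y(1) by (rule measurable_past_imp)
    show "random_variable borel (indicator G :: 'a \<Rightarrow> real)" using Gev by simp
    have sY: "sigma_sets (space M) {Y -` D \<inter> space M |D. D \<in> sets borel} \<subseteq> sets (past n)"
    proof -
      have "{Y -` D \<inter> space M |D. D \<in> sets borel} \<subseteq> sets (past n)"
        using measurable_sets[OF Y(1)] by (auto simp only: space_past)
      from sets.sigma_sets_subset[OF this] show ?thesis by (simp only: space_past)
    qed
    have Gsub: "G \<subseteq> space M" using Gev sets.sets_into_space by blast
    have "indicator G -` D \<inter> space M \<in> sigma_sets (space M) {G}" for D :: "real set"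
    proof -
      have "indicator G -` D \<inter> space M =
          (if 1 \<in> D then G else {}) \<union> (if 0 \<in> D then space M - G else {})"
        using Gsub by (auto simp: indicator_def of_bool_def split: if_splits)
      moreover have "G \<in> sigma_sets (space M) {G}" "space M - G \<in> sigma_sets (space M) {G}"
        by (auto intro: sigma_sets.intros)
      ultimately show ?thesis
        by (simp add: sigma_sets_Un sigma_sets.Empty)
    qed
    then have sG: "sigma_sets (space M) {indicator G -` D \<inter> space M |D. D \<in> sets (borel::real measure)} \<subseteq> sigma_sets (space M) {G}"
      using Gsub by (intro sigma_sets_mono) auto
    show "indep_set (sigma_sets (space M) {Y -` D \<inter> space M |D. D \<in> sets borel})
        (sigma_sets (space M) {indicator G -` D \<inter> space M |D. D \<in> sets (borel::real measure)})"
      unfolding indep_set_def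
    proof (rule indep_sets_mono_sets[OF ind[unfolded indep_set_def]])
      fix b
      show "case_bool (sigma_sets (space M) {Y -` D \<inter> space M |D. D \<in> sets borel})
          (sigma_sets (space M) {indicator G -` D \<inter> space M |D. D \<in> sets (borel::real measure)}) b
          \<subseteq> case_bool (sets (past n)) (sigma_sets (space M) {G}) b"
        by (cases b) (simp_all only: bool.case sY sG)
    qed
  qed
  have int_G: "integrable M (indicator G :: 'a \<Rightarrow> real)"
    using Gev by (simp add: integrable_indicator_iff less_top[symmetric])
  have exp_G: "expectation (indicator G) = prob G"
    using Gev[THEN sets.sets_into_space] by (simp add: Int_absorb2)
  show "expectation (\<lambda>\<omega>. Y \<omega> * indicator G \<omega>) = expectation Y *
     (prob {\<omega> \<in> space M. A (n + 1) \<omega> = B} * prob {\<omega> \<in> space M. U (n + 1) \<omega> = k})"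
    unfolding indep_var_lebesgue_integral[OF indep_YG Y(2) int_G] exp_G prob_G ..
  show "integrable M (\<lambda>\<omega>. Y \<omega> * indicator G \<omega> :: real)"
    by (rule indep_var_integrable[OF indep_YG Y(2) int_G])
qed

text \<open>
  This is the conditional expectation of \<open>\<phi> (X (n + 1))\<close> given the past, in integrated form: \<open>W\<close>
  is the test function. The finitely many values of \<open>A\<close> and \<open>U\<close> are split into the events \<open>G B k\<close>,
  on which the new step is \<open>B *v X k\<close>, a function of the past. Since steps lie in the unit ball,
  boundedness of \<open>\<phi>\<close> there suffices, which admits exponentials.
\<close>
lemma
  fixes W :: "'a \<Rightarrow> real" and \<phi> :: "real^'n::{finite,linorder} \<Rightarrow> real"
  assumes n: "n \<ge> 1" and W: "W \<in> borel_measurable (past n)" "AE \<omega> in M. \<bar>W \<omega>\<bar> \<le> c"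
    and \<phi>: "\<phi> \<in> borel_measurable borel" "\<And>v. norm v \<le> 1 \<Longrightarrow> \<bar>\<phi> v\<bar> \<le> C"
  shows expectation_next_step: "expectation (\<lambda>\<omega>. W \<omega> * \<phi> (X (n + 1) \<omega>)) =
      expectation (\<lambda>\<omega>. W \<omega> * ((\<Sum>k=1..n. mean_step \<phi> (X k \<omega>)) / real n))"
    and integrable_next_step: "integrable M (\<lambda>\<omega>. W \<omega> * \<phi> (X (n + 1) \<omega>))"
    and integrable_next_step_mean: "integrable M (\<lambda>\<omega>. W \<omega> * ((\<Sum>k=1..n. mean_step \<phi> (X k \<omega>)) / real n))"
proof -
  let ?T = "step_matrices :: (real^'n::{finite,linorder}^'n::_) set"
  define G where "G B k = {\<omega> \<in> space M. A (n + 1) \<omega> = B} \<inter> {\<omega> \<in> space M. U (n + 1) \<omega> = k}" for B k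
  define Y where "Y B k \<omega> = W \<omega> * \<phi> (B *v X k \<omega>)" for B k \<omega>
  have Y_past: "Y B k \<in> borel_measurable (past n)" if "k \<in> {1..n}" for B k
  proof -
    have "(\<lambda>v. B *v v) \<in> borel_measurable (borel :: (real^'n::_) measure)"
      by (intro borel_measurable_continuous_onI linear_continuous_on matrix_vector_mul_bounded_linear)
    then show ?thesis
      unfolding Y_def using W(1) \<phi>(1) that
      by (intro borel_measurable_times measurable_compose[OF _ \<phi>(1)] measurable_compose[OF measurable_X_past]) auto
  qed
  have Y_int: "integrable M (Y B k)" if k: "k \<in> {1..n}" and B: "B \<in> ?T" for B k
  proof (rule integrable_const_bound[where B = "c * C"])
    show "AE \<omega> in M. norm (Y B k \<omega>) \<le> c * C"
      using W(2) AE_norm_X_le_1[of n]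
    proof eventually_elim
      case (elim \<omega>)
      have "norm (B *v X k \<omega>) \<le> 1"
        using norm_step_matrix_mult_le[OF B, of "X k \<omega>"] elim(2) k by force
      then show ?case
        unfolding Y_def using elim(1) \<phi>(2) by (auto simp: abs_mult intro!: mult_mono order_trans[OF abs_ge_zero elim(1)])
    qed
    show "random_variable borel (Y B k)" by (rule measurable_past_imp[OF Y_past[OF k]])
  qed
  have W_rv: "random_variable borel W" by (rule measurable_past_imp[OF W(1)])
  have meas: "random_variable borel (\<lambda>\<omega>. W \<omega> * \<phi> (X (n + 1) \<omega>))"
    using W_rv \<phi>(1) X_rv[of "n + 1"] by measurable
  have AE_eq: "AE \<omega> in M. W \<omega> * \<phi> (X (n + 1) \<omega>) = (\<Sum>B\<in>?T. \<Sum>k=1..n. Y B k \<omega> * indicator (G B k) \<omega>)"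
    using AE_A[OF n] AE_U[OF n] AE_space
  proof eventually_elim
    case (elim \<omega>)
    have "(\<Sum>k=1..n. Y B k \<omega> * indicator (G B k) \<omega>) =
        (if B = A (n + 1) \<omega> then Y B (U (n + 1) \<omega>) \<omega> else 0)" for B
    proof -
      have "(\<Sum>k=1..n. Y B k \<omega> * indicator (G B k) \<omega>) =
          (\<Sum>k=1..n. if k = U (n + 1) \<omega> then if B = A (n + 1) \<omega> then Y B k \<omega> else 0 else 0)"
        using elim(3) by (intro sum.cong refl) (auto simp: G_def indicator_def)
      also have "\<dots> = (if B = A (n + 1) \<omega> then Y B (U (n + 1) \<omega>) \<omega> else 0)"
        using elim(2) by (simp only: sum.delta finite_atLeastAtMost if_True)
      finally show ?thesis .
    qed
    then have "(\<Sum>B\<in>?T. \<Sum>k=1..n. Y B k \<omega> * indicator (G B k) \<omega>) =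
        (\<Sum>B\<in>?T. if B = A (n + 1) \<omega> then Y B (U (n + 1) \<omega>) \<omega> else 0)"
      by (intro sum.cong refl)
    also have "\<dots> = Y (A (n + 1) \<omega>) (U (n + 1) \<omega>) \<omega>"
      using elim(1) by (simp only: sum.delta finite_step_matrices if_True)
    finally show ?case by (simp only: Y_def X_step[OF n elim(3)])
  qed
  have part: "integrable M (\<lambda>\<omega>. Y B k \<omega> * indicator (G B k) \<omega>)"
      "expectation (\<lambda>\<omega>. Y B k \<omega> * indicator (G B k) \<omega>) = expectation (Y B k) * (step_weight B * (1 / real n))"
    if k: "k \<in> {1..n}" and B: "B \<in> ?T" for B k
    using expectation_mult_indicator[OF n Y_past[OF k] Y_int[OF k B] G_def]
      prob_A_eq[OF n B] U_uniform[OF n k] by simp_all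
  have sum_int: "integrable M (\<lambda>\<omega>. \<Sum>B\<in>?T. \<Sum>k=1..n. Y B k \<omega> * indicator (G B k) \<omega>)"
    by (intro Bochner_Integration.integrable_sum part)
  then show "integrable M (\<lambda>\<omega>. W \<omega> * \<phi> (X (n + 1) \<omega>))"
    using AE_eq meas by (subst integrable_cong_AE) auto
  have mean_eq: "W \<omega> * ((\<Sum>k=1..n. mean_step \<phi> (X k \<omega>)) / real n) =
      (\<Sum>B\<in>?T. \<Sum>k=1..n. Y B k \<omega> * (step_weight B * (1 / real n)))" for \<omega>
  proof -
    have "W \<omega> * ((\<Sum>k=1..n. mean_step \<phi> (X k \<omega>)) / real n) =
        (\<Sum>k=1..n. \<Sum>B\<in>?T. W \<omega> * (step_weight B * \<phi> (B *v X k \<omega>) / real n))"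
      by (simp only: mean_step_def sum_divide_distrib sum_distrib_left)
    also have "\<dots> = (\<Sum>B\<in>?T. \<Sum>k=1..n. W \<omega> * (step_weight B * \<phi> (B *v X k \<omega>) / real n))"
      by (rule sum.swap)
    also have "\<dots> = (\<Sum>B\<in>?T. \<Sum>k=1..n. Y B k \<omega> * (step_weight B * (1 / real n)))"
      by (intro sum.cong refl) (simp add: Y_def)
    finally show ?thesis .
  qed
  show "integrable M (\<lambda>\<omega>. W \<omega> * ((\<Sum>k=1..n. mean_step \<phi> (X k \<omega>)) / real n))"
    unfolding mean_eq by (intro Bochner_Integration.integrable_sum integrable_mult_left Y_int)
  have "expectation (\<lambda>\<omega>. W \<omega> * \<phi> (X (n + 1) \<omega>)) =
      expectation (\<lambda>\<omega>. \<Sum>B\<in>?T. \<Sum>k=1..n. Y B k \<omega> * indicator (G B k) \<omega>)"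
    using AE_eq meas sum_int by (intro integral_cong_AE) auto
  also have "\<dots> = (\<Sum>B\<in>?T. expectation (\<lambda>\<omega>. \<Sum>k=1..n. Y B k \<omega> * indicator (G B k) \<omega>))"
    by (intro Bochner_Integration.integral_sum Bochner_Integration.integrable_sum part)
  also have "\<dots> = (\<Sum>B\<in>?T. \<Sum>k=1..n. expectation (\<lambda>\<omega>. Y B k \<omega> * indicator (G B k) \<omega>))"
    by (intro sum.cong refl Bochner_Integration.integral_sum part)
  also have "\<dots> = (\<Sum>B\<in>?T. \<Sum>k=1..n. expectation (\<lambda>\<omega>. Y B k \<omega> * (step_weight B * (1 / real n))))"
    by (intro sum.cong refl) (simp only: part integral_mult_left_zero)
  also have "\<dots> = (\<Sum>B\<in>?T. expectation (\<lambda>\<omega>. \<Sum>k=1..n. Y B k \<omega> * (step_weight B * (1 / real n))))"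
    by (intro sum.cong refl Bochner_Integration.integral_sum[symmetric] integrable_mult_left Y_int)
  also have "\<dots> = expectation (\<lambda>\<omega>. \<Sum>B\<in>?T. \<Sum>k=1..n. Y B k \<omega> * (step_weight B * (1 / real n)))"
    by (intro Bochner_Integration.integral_sum[symmetric] Bochner_Integration.integrable_sum integrable_mult_left Y_int)
  also have "\<dots> = expectation (\<lambda>\<omega>. W \<omega> * ((\<Sum>k=1..n. mean_step \<phi> (X k \<omega>)) / real n))"
    by (simp only: mean_eq)
  finally show "expectation (\<lambda>\<omega>. W \<omega> * \<phi> (X (n + 1) \<omega>)) =
      expectation (\<lambda>\<omega>. W \<omega> * ((\<Sum>k=1..n. mean_step \<phi> (X k \<omega>)) / real n))" .
qed

section \<open>The number of nonzero steps\<close>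

text \<open>
  A step almost surely has norm 0 or 1, so this counts the nonzero steps.
\<close>
definition num_moves :: "nat \<Rightarrow> 'a \<Rightarrow> real" where
  "num_moves n \<omega> = (\<Sum>k=1..n. (norm (X k \<omega>))\<^sup>2)"

definition position :: "nat \<Rightarrow> 'a \<Rightarrow> real^'n::{finite,linorder}" where
  "position n \<omega> = (\<Sum>k=1..n. X k \<omega>)"

lemma S_eq_position: "n \<ge> 1 \<Longrightarrow> \<omega> \<in> space M \<Longrightarrow> S n \<omega> = position n \<omega>"
proof (induction n rule: nat_induct_at_least)
  case base
  then show ?case using S_1 by (simp add: position_def)
next
  case (Suc n)
  then show ?case using S_step[of n \<omega>] by (simp add: position_def)
qed

lemma num_moves_nonneg: "num_moves n \<omega> \<ge> 0"
  by (simp add: num_moves_def sum_nonneg)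

lemma num_moves_Suc: "num_moves (n + 1) \<omega> = num_moves n \<omega> + (norm (X (n + 1) \<omega>))\<^sup>2"
  by (simp add: num_moves_def)

lemma position_Suc: "position (n + 1) \<omega> = position n \<omega> + X (n + 1) \<omega>"
  by (simp add: position_def)

lemma measurable_num_moves_past: "k \<le> n \<Longrightarrow> num_moves k \<in> borel_measurable (past n)"
  unfolding num_moves_def
  by (intro borel_measurable_sum borel_measurable_power measurable_compose[OF measurable_X_past] borel_measurable_norm) auto

lemma measurable_position_past: "k \<le> n \<Longrightarrow> position k \<in> borel_measurable (past n)"
  unfolding position_def by (intro borel_measurable_sum measurable_X_past) auto

lemma AE_num_moves_le: "AE \<omega> in M. num_moves n \<omega> \<le> real n"
  using AE_norm_X_le_1[of n]
proof eventually_elim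
  case (elim \<omega>)
  have "num_moves n \<omega> \<le> (\<Sum>k=1..n. 1)"
    unfolding num_moves_def using elim by (intro sum_mono power_le_one) auto
  then show ?case by simp
qed

lemma AE_norm_position_le: "AE \<omega> in M. norm (position n \<omega>) \<le> real n"
  using AE_norm_X_le_1[of n]
proof eventually_elim
  case (elim \<omega>)
  have "norm (position n \<omega>) \<le> (\<Sum>k=1..n. 1)"
    unfolding position_def by (rule sum_norm_le) (use elim in auto)
  then show ?case by simp
qed

definition moves_below :: "real \<Rightarrow> nat \<Rightarrow> 'a set" where
  "moves_below K n = {\<omega> \<in> space M. \<forall>k\<in>{1..n}. num_moves k \<omega> < K * growth (1 - r) k}"

lemma moves_below_past: "moves_below K n \<in> sets (past n)"
proof -
  have "{\<omega> \<in> space (past n). \<forall>k\<in>{1..n}. num_moves k \<omega> < K * growth (1 - r) k} \<in> sets (past n)"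
    by (intro sets.sets_Collect_finite_All borel_measurable_less measurable_num_moves_past) auto
  then show ?thesis by (simp add: moves_below_def)
qed

lemma moves_below_event: "moves_below K n \<in> events"
  using moves_below_past subalgebra_past[of n] by (auto simp: subalgebra_def)

lemma growth_moves_pos: "growth (1 - r) n > 0"
  using r_range by (intro growth_pos) auto

text \<open>
  The maximal inequality for the nonnegative martingale \<open>num_moves n / growth (1 - r) n\<close>, whose
  initial value is at most 1. Keep the martingale as long as it stays below \<open>K\<close> and put the value \<open>K\<close>
  from its first passage on: the resulting process \<open>D\<close> still decreases in mean, because freezing at
  \<open>K\<close> replaces a value that is at least \<open>K\<close>. So the passage probability times \<open>K\<close> is at most 1.
\<close>
lemma prob_moves_below_ge:
  assumes "K > 0" "n \<ge> 1"
  shows "prob (moves_below K n) \<ge> 1 - 1 / K"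
proof -
  let ?g = "growth (1 - r)"
  define I where "I n = (indicator (moves_below K n) :: 'a \<Rightarrow> real)" for n
  define D where "D n \<omega> = I n \<omega> * num_moves n \<omega> / ?g n + K * (1 - I n \<omega>)" for n \<omega>
  have I_past: "I n \<in> borel_measurable (past n)" for n
    unfolding I_def using moves_below_past by simp
  have I_le: "0 \<le> I n \<omega>" "I n \<omega> \<le> 1" for n \<omega> by (simp_all add: I_def)
  have int_I: "integrable M (I n)" for n
    by (rule integrable_const_bound[where B = 1])
       (use I_le in \<open>auto intro!: measurable_past_imp[OF I_past]\<close>)
  have int_IN: "integrable M (\<lambda>\<omega>. I n \<omega> * num_moves n \<omega>)" for n
  proof (rule integrable_const_bound[where B = "real n"])
    show "AE \<omega> in M. norm (I n \<omega> * num_moves n \<omega>) \<le> real n"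
      using AE_num_moves_le[of n]
    proof eventually_elim
      case (elim \<omega>)
      have "I n \<omega> * num_moves n \<omega> \<le> 1 * real n"
        using elim I_le num_moves_nonneg by (intro mult_mono) auto
      then show ?case using I_le[of n \<omega>] num_moves_nonneg[of n \<omega>] by (simp add: abs_mult)
    qed
    show "random_variable borel (\<lambda>\<omega>. I n \<omega> * num_moves n \<omega>)"
      by (intro borel_measurable_times measurable_past_imp[OF I_past] measurable_past_imp[OF measurable_num_moves_past[OF order_refl]])
  qed
  have int_D: "integrable M (D n)" for n
    unfolding D_def by (intro Bochner_Integration.integrable_add integrable_divide int_IN integrable_mult_right Bochner_Integration.integrable_diff integrable_const int_I)
  have step: "expectation (D (n + 1)) \<le> expectation (D n)" if n: "n \<ge> 1" for n
  proof -
    have I_bound: "AE \<omega> in M. \<bar>I n \<omega>\<bar> \<le> 1" using I_le by simp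
    have sq: "(\<lambda>v :: real^'n::_. (norm v)\<^sup>2) \<in> borel_measurable borel"
      by measurable
    have sq_le: "\<bar>(norm v)\<^sup>2\<bar> \<le> 1" if "norm v \<le> 1" for v :: "real^'n::_"
      using that by (simp add: power_le_one)
    note next_step = expectation_next_step[OF n I_past I_bound sq sq_le] integrable_next_step[OF n I_past I_bound sq sq_le]
    have mean: "I n \<omega> * ((\<Sum>k=1..n. mean_step (\<lambda>v. (norm v)\<^sup>2) (X k \<omega>)) / real n) =
        I n \<omega> * num_moves n \<omega> * ((1 - r) / real n)" for \<omega>
      by (simp add: mean_step_norm_sq num_moves_def sum_distrib_left[symmetric])
    have int_next: "integrable M (\<lambda>\<omega>. I n \<omega> * num_moves (n + 1) \<omega>)"
      unfolding num_moves_Suc distrib_left by (intro Bochner_Integration.integrable_add int_IN next_step(2))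
    have "expectation (\<lambda>\<omega>. I n \<omega> * num_moves (n + 1) \<omega>) =
        expectation (\<lambda>\<omega>. I n \<omega> * num_moves n \<omega>) + expectation (\<lambda>\<omega>. I n \<omega> * (norm (X (n + 1) \<omega>))\<^sup>2)"
      unfolding num_moves_Suc distrib_left by (intro Bochner_Integration.integral_add int_IN next_step(2))
    also have "\<dots> = expectation (\<lambda>\<omega>. I n \<omega> * num_moves n \<omega>) * (1 + (1 - r) / real n)"
      by (simp only: next_step(1) mean integral_mult_left_zero distrib_left mult_1_right)
    finally have IN: "expectation (\<lambda>\<omega>. I n \<omega> * num_moves (n + 1) \<omega>) / ?g (n + 1) =
        expectation (\<lambda>\<omega>. I n \<omega> * num_moves n \<omega>) / ?g n"
      using growth_Suc[OF n, of "1 - r"] growth_moves_pos[of n] growth_moves_pos[of "n + 1"] by (simp add: field_simps)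
    have "D (n + 1) \<omega> \<le> I n \<omega> * num_moves (n + 1) \<omega> / ?g (n + 1) + K * (1 - I n \<omega>)"
      if "\<omega> \<in> space M" for \<omega>
    proof (cases "\<omega> \<in> moves_below K (n + 1)")
      case True
      then have "\<omega> \<in> moves_below K n" by (auto simp: moves_below_def)
      then show ?thesis using True by (simp add: D_def I_def)
    next
      case False
      show ?thesis
      proof (cases "\<omega> \<in> moves_below K n")
        case below: True
        then have "num_moves (n + 1) \<omega> \<ge> K * ?g (n + 1)"
          using False that by (auto simp: moves_below_def le_Suc_eq)
        then show ?thesis using False below growth_moves_pos[of "n + 1"] by (simp add: D_def I_def field_simps)
      qed (use False in \<open>simp add: D_def I_def\<close>)
    qed
    then have "expectation (D (n + 1)) \<le>
        expectation (\<lambda>\<omega>. I n \<omega> * num_moves (n + 1) \<omega> / ?g (n + 1) + K * (1 - I n \<omega>))"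
      by (intro integral_mono int_D Bochner_Integration.integrable_add integrable_divide int_next integrable_mult_right Bochner_Integration.integrable_diff integrable_const int_I)
    also have "\<dots> = expectation (\<lambda>\<omega>. I n \<omega> * num_moves (n + 1) \<omega>) / ?g (n + 1) + expectation (\<lambda>\<omega>. K * (1 - I n \<omega>))"
      by (subst Bochner_Integration.integral_add)
         (intro integrable_divide int_next integrable_mult_right Bochner_Integration.integrable_diff integrable_const int_I refl
           | simp only: integral_divide_zero)+
    also have "\<dots> = expectation (\<lambda>\<omega>. I n \<omega> * num_moves n \<omega>) / ?g n + expectation (\<lambda>\<omega>. K * (1 - I n \<omega>))"
      by (simp only: IN)
    also have "\<dots> = expectation (D n)"
      unfolding D_def by (subst Bochner_Integration.integral_add) (auto intro!: int_IN integrable_divide integrable_mult_right int_I)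
    finally show ?thesis .
  qed
  have base: "expectation (D 1) \<le> 1"
  proof -
    have "AE \<omega> in M. D 1 \<omega> \<le> 1"
      using AE_num_moves_le[of 1] AE_space
    proof eventually_elim
      case (elim \<omega>)
      have "\<omega> \<notin> moves_below K 1 \<Longrightarrow> num_moves 1 \<omega> \<ge> K"
        using elim(2) by (auto simp: moves_below_def)
      then show ?case using elim(1) by (cases "\<omega> \<in> moves_below K 1") (auto simp: D_def I_def)
    qed
    then have "expectation (D 1) \<le> expectation (\<lambda>_. 1)"
      by (intro integral_mono_AE int_D) auto
    then show ?thesis by (simp add: prob_space)
  qed
  have "expectation (D n) \<le> 1"
    using \<open>n \<ge> 1\<close>
  proof (induction n rule: nat_induct_at_least)
    case (Suc n)
    then show ?case using step[of n] by simp
  qed (use base in simp)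
  moreover have "expectation (\<lambda>\<omega>. K * (1 - I n \<omega>)) \<le> expectation (D n)"
    unfolding D_def using growth_moves_pos[of n] I_le num_moves_nonneg
    by (intro integral_mono Bochner_Integration.integrable_add integrable_divide int_IN integrable_mult_right Bochner_Integration.integrable_diff integrable_const int_I)
       auto
  moreover have "expectation (\<lambda>\<omega>. K * (1 - I n \<omega>)) = K * (1 - prob (moves_below K n))"
    using moves_below_event[of K n, THEN sets.sets_into_space] int_I[of n]
    by (simp add: I_def prob_space Int_absorb2)
  ultimately have "K * (1 - prob (moves_below K n)) \<le> 1" by linarith
  then show ?thesis using assms(1) by (simp add: field_simps)
qed

text \<open>
  By continuity from above the maximal inequality holds for all times at once, and then \<open>K\<close> tends to
  infinity.
\<close>
lemma AE_num_moves_bounded: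
  "AE \<omega> in M. \<exists>K::nat. \<forall>k\<ge>1. num_moves k \<omega> < real K * growth (1 - r) k"
proof -
  define E where "E K = (\<Inter>n. moves_below (real (Suc K)) n)" for K
  have E_ev: "E K \<in> events" for K
    unfolding E_def by (intro sets.countable_INT) (use moves_below_event in auto)
  have prob_E: "prob (E K) \<ge> 1 - 1 / real (Suc K)" for K
  proof -
    have "(\<lambda>n. prob (moves_below (real (Suc K)) n)) \<longlonglongrightarrow> prob (E K)"
      unfolding E_def
      by (intro finite_Lim_measure_decseq) (use moves_below_event in \<open>auto simp: decseq_def moves_below_def\<close>)
    then show ?thesis
      by (rule LIMSEQ_le_const) (use prob_moves_below_ge[of "real (Suc K)"] in auto)
  qed
  define F where "F = (\<Union>K. E K)"
  have F_ev: "F \<in> events" unfolding F_def using E_ev by auto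
  have "1 - 1 / real (Suc K) \<le> prob F" for K
    using prob_E[of K] finite_measure_mono[of "E K" F] F_ev unfolding F_def by force
  moreover have "(\<lambda>K. 1 - 1 / real (Suc K)) \<longlonglongrightarrow> 1 - 0"
    by (intro tendsto_diff tendsto_const LIMSEQ_inverse_real_of_nat[unfolded inverse_eq_divide])
  ultimately have "1 \<le> prob F"
    by (intro LIMSEQ_le_const2[of "\<lambda>K. 1 - 1 / real (Suc K)"]) auto
  then have "prob F = 1" using prob_le_1[of F] by linarith
  then have "AE \<omega> in M. \<omega> \<in> F" by (rule AE_prob_1)
  then show ?thesis
  proof eventually_elim
    case (elim \<omega>)
    then obtain K where "\<And>n. \<omega> \<in> moves_below (real (Suc K)) n" by (auto simp: F_def E_def)
    then have "\<forall>k\<ge>1. num_moves k \<omega> < real (Suc K) * growth (1 - r) k"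
      unfolding moves_below_def by (metis (mono_tags, lifting) atLeastAtMost_iff mem_Collect_eq order_refl)
    then show ?case by blast
  qed
qed

section \<open>An exponential supermartingale\<close>

lemma integrable_exp_position:
  assumes "V \<in> borel_measurable (past n)" "\<And>\<omega>. V \<omega> \<ge> 0"
  shows "integrable M (\<lambda>\<omega>. exp (\<theta> \<bullet> position n \<omega> - V \<omega>))"
    and "AE \<omega> in M. \<bar>exp (\<theta> \<bullet> position n \<omega> - V \<omega>)\<bar> \<le> exp (norm \<theta> * real n)"
proof -
  show bound: "AE \<omega> in M. \<bar>exp (\<theta> \<bullet> position n \<omega> - V \<omega>)\<bar> \<le> exp (norm \<theta> * real n)"
    using AE_norm_position_le[of n]
  proof eventually_elim
    case (elim \<omega>)
    have "\<theta> \<bullet> position n \<omega> \<le> norm \<theta> * norm (position n \<omega>)" by (rule norm_cauchy_schwarz)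
    also have "\<dots> \<le> norm \<theta> * real n" using elim by (rule mult_left_mono) simp
    finally show ?case using assms(2)[of \<omega>] by simp
  qed
  show "integrable M (\<lambda>\<omega>. exp (\<theta> \<bullet> position n \<omega> - V \<omega>))"
  proof (rule integrable_const_bound)
    show "AE \<omega> in M. norm (exp (\<theta> \<bullet> position n \<omega> - V \<omega>)) \<le> exp (norm \<theta> * real n)"
      using bound by simp
    show "random_variable borel (\<lambda>\<omega>. exp (\<theta> \<bullet> position n \<omega> - V \<omega>))"
      using measurable_past_imp[OF assms(1)] measurable_past_imp[OF measurable_position_past[OF order_refl, of n]]
      by measurable
  qed
qed

text \<open>
  By \<open>mean_step_exp_le\<close> and \<open>1 + y \<le> exp y\<close>, one step multiplies the exponential in mean by at
  most the exponential of \<open>(drift * (\<theta> \<bullet> position n) + (norm \<theta>)\<^sup>2 * num_moves n) / n\<close>. The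
  first summand is absorbed by changing \<open>\<theta>\<close> to \<open>(1 + drift / n) *\<^sub>R \<theta>\<close>, the second by the compensator.
\<close>
lemma exp_position_step:
  assumes n: "n \<ge> 1" and \<theta>: "norm \<theta> \<le> 1"
    and V: "V \<in> borel_measurable (past n)" "\<And>\<omega>. V \<omega> \<ge> 0"
  shows "expectation (\<lambda>\<omega>. exp (\<theta> \<bullet> position (n + 1) \<omega> - (V \<omega> + (norm \<theta>)\<^sup>2 * num_moves n \<omega> / real n))) \<le>
    expectation (\<lambda>\<omega>. exp (((1 + drift / real n) *\<^sub>R \<theta>) \<bullet> position n \<omega> - V \<omega>))"
proof -
  define V' where "V' \<omega> = V \<omega> + (norm \<theta>)\<^sup>2 * num_moves n \<omega> / real n" for \<omega>
  define W where "W \<omega> = exp (\<theta> \<bullet> position n \<omega> - V' \<omega>)" for \<omega>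
  have V': "V' \<in> borel_measurable (past n)" "\<And>\<omega>. V' \<omega> \<ge> 0"
    unfolding V'_def using V num_moves_nonneg measurable_num_moves_past[OF order_refl, of n]
    by (auto intro!: add_nonneg_nonneg)
  have W_past: "W \<in> borel_measurable (past n)"
    unfolding W_def using V'(1) measurable_position_past[OF order_refl, of n] by measurable
  have W_bound: "AE \<omega> in M. \<bar>W \<omega>\<bar> \<le> exp (norm \<theta> * real n)"
    unfolding W_def by (rule integrable_exp_position(2)[OF V'])
  have phi: "(\<lambda>v. exp (\<theta> \<bullet> v)) \<in> borel_measurable borel" by measurable
  have phi_le: "\<bar>exp (\<theta> \<bullet> v)\<bar> \<le> exp 1" if "norm v \<le> 1" for v
  proof -
    have "\<theta> \<bullet> v \<le> norm \<theta> * norm v" by (rule norm_cauchy_schwarz)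
    also have "\<dots> \<le> 1" using \<theta> that by (simp add: mult_le_one)
    finally show ?thesis by simp
  qed
  note next_step = expectation_next_step[OF n W_past W_bound phi phi_le]
    integrable_next_step_mean[OF n W_past W_bound phi phi_le]
  have "expectation (\<lambda>\<omega>. exp (\<theta> \<bullet> position (n + 1) \<omega> - V' \<omega>)) =
      expectation (\<lambda>\<omega>. W \<omega> * exp (\<theta> \<bullet> X (n + 1) \<omega>))"
    unfolding position_Suc W_def by (simp add: inner_add_right exp_add[symmetric] algebra_simps)
  also have "\<dots> = expectation (\<lambda>\<omega>. W \<omega> * ((\<Sum>k=1..n. mean_step (\<lambda>v. exp (\<theta> \<bullet> v)) (X k \<omega>)) / real n))"
    by (rule next_step(1))
  also have "\<dots> \<le> expectation (\<lambda>\<omega>. exp (((1 + drift / real n) *\<^sub>R \<theta>) \<bullet> position n \<omega> - V \<omega>))"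
  proof (rule integral_mono_AE)
    show "AE \<omega> in M. W \<omega> * ((\<Sum>k=1..n. mean_step (\<lambda>v. exp (\<theta> \<bullet> v)) (X k \<omega>)) / real n) \<le>
        exp (((1 + drift / real n) *\<^sub>R \<theta>) \<bullet> position n \<omega> - V \<omega>)"
      using AE_norm_X_le_1[of n]
    proof eventually_elim
      case (elim \<omega>)
      define y where "y = (drift * (\<theta> \<bullet> position n \<omega>) + (norm \<theta>)\<^sup>2 * num_moves n \<omega>) / real n"
      have "(\<Sum>k=1..n. mean_step (\<lambda>v. exp (\<theta> \<bullet> v)) (X k \<omega>)) \<le>
          (\<Sum>k=1..n. 1 + drift * (\<theta> \<bullet> X k \<omega>) + (norm \<theta>)\<^sup>2 * (norm (X k \<omega>))\<^sup>2)"
        using elim \<theta> by (intro sum_mono mean_step_exp_le) auto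
      also have "\<dots> = real n + drift * (\<theta> \<bullet> position n \<omega>) + (norm \<theta>)\<^sup>2 * num_moves n \<omega>"
        by (simp only: sum.distrib sum_distrib_left[symmetric] inner_sum_right[symmetric]
            position_def[symmetric] num_moves_def[symmetric]) simp
      also have "\<dots> = real n * (1 + y)"
        using n by (simp add: y_def field_simps)
      finally have "(\<Sum>k=1..n. mean_step (\<lambda>v. exp (\<theta> \<bullet> v)) (X k \<omega>)) / real n \<le> 1 + y"
        using n by (simp add: field_simps)
      also have "\<dots> \<le> exp y" by (rule exp_ge_add_one_self)
      finally have "W \<omega> * ((\<Sum>k=1..n. mean_step (\<lambda>v. exp (\<theta> \<bullet> v)) (X k \<omega>)) / real n) \<le> W \<omega> * exp y"
        by (rule mult_left_mono) (simp add: W_def)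
      also have "W \<omega> * exp y = exp (((1 + drift / real n) *\<^sub>R \<theta>) \<bullet> position n \<omega> - V \<omega>)"
        unfolding W_def V'_def y_def exp_add[symmetric]
        by (simp add: add_divide_distrib diff_divide_distrib algebra_simps)
      finally show ?case .
    qed
    show "integrable M (\<lambda>\<omega>. W \<omega> * ((\<Sum>k=1..n. mean_step (\<lambda>v. exp (\<theta> \<bullet> v)) (X k \<omega>)) / real n))"
      by (rule next_step(2))
    show "integrable M (\<lambda>\<omega>. exp (((1 + drift / real n) *\<^sub>R \<theta>) \<bullet> position n \<omega> - V \<omega>))"
      using V by (rule integrable_exp_position(1))
  qed
  finally show ?thesis by (simp only: V'_def)
qed

text \<open>
  The recursion for \<open>\<theta>\<close> is solved by a constant vector divided by \<open>growth drift k\<close>. The bound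
  \<open>norm (\<theta> k) \<le> 1\<close> is what the quadratic estimate of the exponential needs, and it also gives
  the initial bound \<open>exp 1\<close>.
\<close>
lemma exp_position_supermartingale:
  fixes \<theta> :: "nat \<Rightarrow> real^'n::{finite,linorder}"
  assumes rec: "\<And>k. 1 \<le> k \<Longrightarrow> \<theta> k = (1 + drift / real k) *\<^sub>R \<theta> (k + 1)"
    and le: "\<And>k. 1 \<le> k \<Longrightarrow> k \<le> m \<Longrightarrow> norm (\<theta> k) \<le> 1" and m: "m \<ge> 1"
  shows "expectation (\<lambda>\<omega>. exp (\<theta> m \<bullet> position m \<omega> -
      (\<Sum>k=1..<m. (norm (\<theta> (k + 1)))\<^sup>2 * num_moves k \<omega> / real k))) \<le> exp 1"
  using m le
proof (induction m rule: nat_induct_at_least)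
  case base
  have "AE \<omega> in M. \<bar>exp (\<theta> 1 \<bullet> position 1 \<omega> - 0)\<bar> \<le> exp (norm (\<theta> 1) * real 1)"
    by (rule integrable_exp_position(2)) auto
  then have "AE \<omega> in M. exp (\<theta> 1 \<bullet> position 1 \<omega>) \<le> exp 1"
    by eventually_elim (use base[of 1] in auto)
  moreover have "integrable M (\<lambda>\<omega>. exp (\<theta> 1 \<bullet> position 1 \<omega> - 0))"
    by (rule integrable_exp_position(1)) auto
  ultimately have "expectation (\<lambda>\<omega>. exp (\<theta> 1 \<bullet> position 1 \<omega>)) \<le> expectation (\<lambda>_. exp 1)"
    by (intro integral_mono_AE) auto
  then show ?case by (simp add: prob_space)
next
  case (Suc n)
  define V where "V \<omega> = (\<Sum>k=1..<n. (norm (\<theta> (k + 1)))\<^sup>2 * num_moves k \<omega> / real k)" for \<omega>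
  have V: "V \<in> borel_measurable (past n)" "\<And>\<omega>. V \<omega> \<ge> 0"
    unfolding V_def using num_moves_nonneg
    by (auto intro!: borel_measurable_sum borel_measurable_divide borel_measurable_times measurable_num_moves_past sum_nonneg)
  have "norm (\<theta> (n + 1)) \<le> 1" using Suc.prems[of "n + 1"] by simp
  from exp_position_step[OF Suc.hyps this V]
  have "expectation (\<lambda>\<omega>. exp (\<theta> (n + 1) \<bullet> position (n + 1) \<omega> - (V \<omega> + (norm (\<theta> (n + 1)))\<^sup>2 * num_moves n \<omega> / real n)))
      \<le> expectation (\<lambda>\<omega>. exp (\<theta> n \<bullet> position n \<omega> - V \<omega>))"
    by (simp only: rec[OF Suc.hyps, symmetric])
  also have "\<dots> \<le> exp 1" unfolding V_def using Suc.prems by (intro Suc.IH) auto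
  finally show ?case using Suc.hyps by (simp add: V_def)
qed

section \<open>The diffusive regime\<close>

text \<open>
  The bound makes \<open>1 + drift / k\<close> at least \<open>r > 0\<close> for all \<open>k \<ge> 1\<close>, so the products \<open>growth drift k\<close> are
  positive.
\<close>
lemma drift_ge: "drift \<ge> - (1 - r)"
proof -
  have "1 * q \<le> (2 * real CARD('n) - 1) * q"
    using q_range by (intro mult_right_mono) (auto simp: Suc_leI)
  then show ?thesis using total p_range by auto
qed

lemma drift_gt: "drift > -1"
  using drift_ge r_range by auto

lemma drift_less:
  assumes "p < merws_threshold CARD('n) r"
  shows "2 * drift < 1 - r"
proof -
  define d where "d = real CARD('n)"
  have d: "d \<ge> 1" by (simp add: d_def Suc_leI)
  have "4 * d * p < (2 * d + 1) * (1 - r)"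
    using assms d by (simp add: merws_threshold_def d_def[symmetric] field_simps)
  moreover have "(2 * d - 1) * q = 1 - r - p" using total by (simp add: d_def)
  ultimately have "(2 * d - 1) * (2 * drift) < (2 * d - 1) * (1 - r)"
    by (simp add: algebra_simps)
  then show ?thesis using d by simp
qed

lemma growth_drift_pos: "growth drift n > 0"
  using drift_gt by (rule growth_pos)

text \<open>
  The left-hand side is the compensator for \<open>num_moves k = growth (1 - r) k\<close>. Its terms are of order
  \<open>k powr (s - 1)\<close> with \<open>s = 1 - r - 2 * drift\<close>; positivity of \<open>s\<close> is the diffusive condition.
\<close>
lemma variation_bound:
  assumes "2 * drift < 1 - r"
  obtains C where "C > 0" "\<And>m. m \<ge> 1 \<Longrightarrow>
    (\<Sum>k=1..<m. growth (1 - r) k / (real k * (growth drift (k + 1))\<^sup>2)) \<le> C * real m powr (1 - r - 2 * drift)"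
proof -
  define s where "s = 1 - r - 2 * drift"
  have s: "s > 0" using assms by (simp add: s_def)
  obtain C1 where C1: "C1 > 0" "\<And>n. n \<ge> 1 \<Longrightarrow> growth (1 - r) n \<le> C1 * real n powr (1 - r)"
    using growth_powr_bounds[of "1 - r"] r_range by (metis diff_gt_0_iff_gt greaterThanLessThan_iff less_trans neg_less_0_iff_less zero_less_one)
  obtain c where c: "c > 0" "\<And>n. n \<ge> 1 \<Longrightarrow> c * real n powr drift \<le> growth drift n"
    using growth_powr_bounds[OF drift_gt] by metis
  obtain C2 where C2: "C2 > 0" "\<And>m. m \<ge> 1 \<Longrightarrow> (\<Sum>k=1..<m. real k powr (s - 1)) \<le> C2 * real m powr s"
    using sum_powr_le[OF s] by metis
  define D where "D = C1 / (r * c)\<^sup>2"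
  have r: "r > 0" using r_range by simp
  have D: "D > 0" using C1 c r by (simp add: D_def)
  have term_le: "growth (1 - r) k / (real k * (growth drift (k + 1))\<^sup>2) \<le> D * real k powr (s - 1)"
    if k: "k \<ge> 1" for k
  proof -
    have "drift / real k \<ge> - (1 - r)"
    proof -
      have "- (1 - r) * real k \<le> - (1 - r) * 1"
        using k r_range by (intro mult_left_mono_neg) auto
      also have "- (1 - r) * 1 \<le> drift" using drift_ge by simp
      finally show ?thesis using k by (simp add: field_simps)
    qed
    then have "r \<le> 1 + drift / real k" by simp
    then have "c * real k powr drift * r \<le> growth drift k * (1 + drift / real k)"
      using c(2)[OF k] c(1) r growth_drift_pos[of k] by (intro mult_mono) auto
    then have "(r * c) * real k powr drift \<le> growth drift (k + 1)"
      using growth_Suc[OF k, of drift] by (simp add: mult_ac)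
    then have "((r * c) * real k powr drift)\<^sup>2 \<le> (growth drift (k + 1))\<^sup>2"
      using r c by (intro power_mono) auto
    then have "growth (1 - r) k / (real k * (growth drift (k + 1))\<^sup>2) \<le>
        C1 * real k powr (1 - r) / (real k * ((r * c) * real k powr drift)\<^sup>2)"
      using C1(2)[OF k] C1(1) k r c by (intro frac_le mult_left_mono) auto
    also have "\<dots> = D * (real k powr (1 - r) / (real k * (real k powr drift)\<^sup>2))"
      by (simp add: D_def power_mult_distrib)
    also have "real k powr (1 - r) / (real k * (real k powr drift)\<^sup>2) = real k powr (s - 1)"
    proof -
      have "(real k powr drift)\<^sup>2 = real k powr (2 * drift)"
        using k by (simp add: powr_realpow[symmetric] powr_powr mult.commute)
      moreover have "real k = real k powr 1" using k by simp
      ultimately have "real k * (real k powr drift)\<^sup>2 = real k powr (1 + 2 * drift)"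
        by (metis powr_add)
      then show ?thesis by (simp add: s_def powr_diff[symmetric] algebra_simps)
    qed
    finally show ?thesis .
  qed
  show thesis
  proof (rule that[of "D * C2"])
    fix m :: nat assume m: "m \<ge> 1"
    have "(\<Sum>k=1..<m. growth (1 - r) k / (real k * (growth drift (k + 1))\<^sup>2)) \<le>
        (\<Sum>k=1..<m. D * real k powr (s - 1))"
      by (intro sum_mono term_le) auto
    also have "\<dots> \<le> D * (C2 * real m powr s)"
      using C2(2)[OF m] D by (simp add: sum_distrib_left[symmetric])
    finally show "(\<Sum>k=1..<m. growth (1 - r) k / (real k * (growth drift (k + 1))\<^sup>2)) \<le>
        D * C2 * real m powr (1 - r - 2 * drift)" by (simp add: s_def)
  qed (use D C2 in simp)
qed

text \<open>
  The scale of the exponential test at time \<open>m\<close>. Its square times the variation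
  \<open>m powr (1 - r - 2 * drift)\<close> is \<open>ln m\<close>, the same order as the deviation level \<open>2 * ln m\<close> that makes
  the probabilities summable.
\<close>
definition tilt :: "nat \<Rightarrow> real" where
  "tilt m = sqrt (ln (real m)) * real m powr (- ((1 - r - 2 * drift) / 2))"

text \<open>
  The quotient is largest at \<open>k = 1\<close> or at \<open>k = m\<close>, up to constants, according to the sign of the
  drift. The bound \<open>k powr (- drift) \<le> 1 + m powr (- drift)\<close> covers both cases.
\<close>
lemma tilt_small:
  assumes "2 * drift < 1 - r"
  shows "\<forall>\<^sub>F m in sequentially. \<forall>k\<in>{1..m}. tilt m / growth drift k \<le> 1"
proof -
  obtain c where c: "c > 0" "\<And>n. n \<ge> 1 \<Longrightarrow> c * real n powr drift \<le> growth drift n"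
    using growth_powr_bounds[OF drift_gt] by metis
  have "(\<lambda>m. (sqrt (ln (real m)) * real m powr (- ((1 - r - 2 * drift) / 2)) +
      sqrt (ln (real m)) * real m powr (- ((1 - r) / 2))) / c) \<longlonglongrightarrow> (0 + 0) / c"
    using assms r_range c(1) by (intro tendsto_divide tendsto_add sqrt_ln_powr_tendsto_0 tendsto_const) auto
  then have "\<forall>\<^sub>F m in sequentially. (sqrt (ln (real m)) * real m powr (- ((1 - r - 2 * drift) / 2)) +
      sqrt (ln (real m)) * real m powr (- ((1 - r) / 2))) / c < 1"
    by (rule order_tendstoD) simp
  then show ?thesis
    using eventually_ge_at_top[of 1]
  proof eventually_elim
    case (elim m)
    show ?case
    proof
      fix k assume k: "k \<in> {1..m}"
      have "1 / growth drift k \<le> 1 / (c * real k powr drift)"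
        using c k by (intro frac_le) auto
      also have "\<dots> = real k powr (- drift) / c"
        by (simp only: powr_minus) (simp add: field_simps)
      also have "real k powr (- drift) \<le> 1 + real m powr (- drift)"
      proof (cases "drift \<ge> 0")
        case True
        then have "real k powr (- drift) \<le> 1"
          using k powr_mono[of "- drift" 0 "real k"] by auto
        then show ?thesis by (simp add: add_increasing2)
      next
        case False
        then have "real k powr (- drift) \<le> real m powr (- drift)"
          using k by (intro powr_mono2) auto
        then show ?thesis by simp
      qed
      finally have "1 / growth drift k \<le> (1 + real m powr (- drift)) / c"
        using c(1) by (simp add: divide_right_mono)
      then have "tilt m * (1 / growth drift k) \<le> tilt m * ((1 + real m powr (- drift)) / c)"
        using elim(2) by (intro mult_left_mono) (auto simp: tilt_def)
      also have "\<dots> = (sqrt (ln (real m)) * real m powr (- ((1 - r - 2 * drift) / 2)) +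
          sqrt (ln (real m)) * real m powr (- ((1 - r) / 2))) / c"
      proof -
        have "real m powr (- ((1 - r - 2 * drift) / 2)) * real m powr (- drift) = real m powr (- ((1 - r) / 2))"
        proof -
          have "- ((1 - r - 2 * drift) / 2) + - drift = - ((1 - r) / 2)" by (simp add: field_simps)
          then show ?thesis by (simp only: powr_add[symmetric])
        qed
        then have "tilt m * real m powr (- drift) = sqrt (ln (real m)) * real m powr (- ((1 - r) / 2))"
          by (simp only: tilt_def mult.assoc)
        then show ?thesis
          by (simp only: times_divide_eq_right distrib_left mult_1_right) (simp only: tilt_def)
      qed
      finally show "tilt m / growth drift k \<le> 1" using elim(1) by simp
    qed
  qed
qed

section \<open>Deviation bounds and the almost sure rate\<close>

text \<open>
  For each \<open>m\<close> a different supermartingale is used, evaluated at its final time \<open>m\<close>. The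
  complementary events have probability at most \<open>exp 1 / m\<^sup>2\<close>, so the Borel-Cantelli lemma applies.
\<close>
lemma AE_eventually_tilted_position_less:
  fixes w :: "real^'n::{finite,linorder}"
  assumes drift: "2 * drift < 1 - r" and w: "norm w = 1"
  shows "AE \<omega> in M. \<forall>\<^sub>F m in sequentially.
    tilt m / growth drift m * (w \<bullet> position m \<omega>) -
      (\<Sum>k=1..<m. (tilt m / growth drift (k + 1))\<^sup>2 * num_moves k \<omega> / real k) < 2 * ln (real m)"
proof -
  define Z where "Z m \<omega> = tilt m / growth drift m * (w \<bullet> position m \<omega>) -
      (\<Sum>k=1..<m. (tilt m / growth drift (k + 1))\<^sup>2 * num_moves k \<omega> / real k)" for m \<omega>
  define E where "E m = {\<omega> \<in> space M. Z m \<omega> \<ge> 2 * ln (real m)}" for m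
  have tilt_nonneg: "tilt m \<ge> 0" if "m \<ge> 1" for m
    using that by (simp add: tilt_def)
  have pos_rv [measurable]: "random_variable borel (position n)" "random_variable borel (num_moves n)" for n
    by (auto intro: measurable_past_imp measurable_position_past[OF order_refl] measurable_num_moves_past[OF order_refl])
  have Z_rv [measurable]: "random_variable borel (Z m)" for m
    unfolding Z_def by measurable
  have E_ev: "E m \<in> events" for m
    unfolding E_def by measurable
  have prob_E: "\<forall>\<^sub>F m in sequentially. norm (prob (E m)) \<le> exp 1 * (1 / (real m)\<^sup>2)"
    using tilt_small[OF drift] eventually_ge_at_top[of 1]
  proof eventually_elim
    case (elim m)
    define \<theta> where "\<theta> k = (tilt m / growth drift k) *\<^sub>R w" for k
    have norm_\<theta>: "norm (\<theta> k) = tilt m / growth drift k" for k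
      using tilt_nonneg[OF elim(2)] growth_drift_pos[of k] w by (simp add: \<theta>_def)
    have rec: "\<theta> k = (1 + drift / real k) *\<^sub>R \<theta> (k + 1)" if "1 \<le> k" for k
    proof -
      have "1 + drift / real k \<noteq> 0"
        using growth_Suc[OF that, of drift] growth_drift_pos[of "Suc k"] by auto
      then show ?thesis using growth_Suc[OF that, of drift] by (simp add: \<theta>_def)
    qed
    have Z_eq: "Z m \<omega> = \<theta> m \<bullet> position m \<omega> -
        (\<Sum>k=1..<m. (norm (\<theta> (k + 1)))\<^sup>2 * num_moves k \<omega> / real k)" for \<omega>
      unfolding norm_\<theta> by (simp add: Z_def \<theta>_def)
    have expectation_le: "expectation (\<lambda>\<omega>. exp (Z m \<omega>)) \<le> exp 1"
      unfolding Z_eq by (rule exp_position_supermartingale[OF rec]) (use elim norm_\<theta> in auto)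
    have "integrable M (\<lambda>\<omega>. exp (Z m \<omega>))"
      unfolding Z_eq
      by (rule integrable_exp_position(1))
         (auto intro!: borel_measurable_sum borel_measurable_divide borel_measurable_times measurable_num_moves_past sum_nonneg divide_nonneg_nonneg mult_nonneg_nonneg num_moves_nonneg)
    then have "prob {\<omega> \<in> space M. exp (Z m \<omega>) \<ge> (real m)\<^sup>2} \<le> expectation (\<lambda>\<omega>. exp (Z m \<omega>)) / (real m)\<^sup>2"
      using elim(2) by (intro integral_Markov_inequality_measure[where A="{}"]) auto
    also have "\<dots> \<le> exp 1 * (1 / (real m)\<^sup>2)"
      using expectation_le by (simp add: divide_right_mono)
    also have "{\<omega> \<in> space M. exp (Z m \<omega>) \<ge> (real m)\<^sup>2} = E m"
    proof -
      have "exp (2 * ln (real m)) = exp (ln (real m)) * exp (ln (real m))"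
        by (simp only: mult_2 exp_add)
      also have "\<dots> = (real m)\<^sup>2" using elim(2) by (simp add: power2_eq_square)
      finally have "(real m)\<^sup>2 = exp (2 * ln (real m))" ..
      then show ?thesis by (simp add: E_def)
    qed
    finally show ?case by simp
  qed
  have "summable (\<lambda>m. exp 1 * (1 / (real m)\<^sup>2))"
    using inverse_power_summable[of 2, where 'a=real] by (intro summable_mult) (simp add: inverse_eq_divide)
  then have "summable (\<lambda>m. prob (E m))"
    by (rule summable_comparison_test_ev[OF prob_E])
  then have "AE \<omega> in M. \<forall>\<^sub>F m in sequentially. \<omega> \<in> space M - E m"
    using E_ev by (intro borel_cantelli_AE1) (auto simp: less_top[symmetric])
  then show ?thesis
  proof eventually_elim
    case (elim \<omega>)
    then show ?case by eventually_elim (auto simp: E_def Z_def not_le)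
  qed
qed

text \<open>
  The random constant \<open>K\<close> that controls the number of nonzero steps turns the compensator into at
  most \<open>K * Cv * ln m\<close>. Division by \<open>tilt m / growth drift m\<close>, which is of order at least
  \<open>sqrt (ln m) / m powr ((1 - r) / 2)\<close>, gives the claim.
\<close>
lemma AE_position_directional_bound:
  fixes w :: "real^'n::{finite,linorder}"
  assumes drift: "2 * drift < 1 - r" and w: "norm w = 1"
  shows "AE \<omega> in M. \<exists>C\<ge>0. \<forall>\<^sub>F m in sequentially. w \<bullet> position m \<omega> \<le> C * (sqrt (ln (real m)) * real m powr ((1 - r) / 2))"
proof -
  obtain Cv where Cv: "Cv > 0" "\<And>m. m \<ge> 1 \<Longrightarrow>
    (\<Sum>k=1..<m. growth (1 - r) k / (real k * (growth drift (k + 1))\<^sup>2)) \<le> Cv * real m powr (1 - r - 2 * drift)"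
    by (rule variation_bound[OF drift]) (rule that)
  obtain Cd where Cd: "Cd > 0" "\<And>n. n \<ge> 1 \<Longrightarrow> growth drift n \<le> Cd * real n powr drift"
    using growth_powr_bounds[OF drift_gt] by metis
  from AE_eventually_tilted_position_less[OF assms] AE_num_moves_bounded show ?thesis
  proof eventually_elim
    case (elim \<omega>)
    obtain K :: nat where K: "\<And>k. k \<ge> 1 \<Longrightarrow> num_moves k \<omega> < real K * growth (1 - r) k"
      using elim(2) by auto
    define B where "B = 2 + real K * Cv"
    have B: "B \<ge> 0" using Cv(1) by (simp add: B_def)
    have "\<forall>\<^sub>F m in sequentially. w \<bullet> position m \<omega> \<le> B * Cd * (sqrt (ln (real m)) * real m powr ((1 - r) / 2))"
      using elim(1) eventually_ge_at_top[of 2]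
    proof eventually_elim
      case (elim m)
      have ln_pos: "ln (real m) > 0" using elim(2) by simp
      have m: "m \<ge> 1" using elim(2) by simp
      define t where "t = real m powr (- ((1 - r - 2 * drift) / 2))"
      have t: "t > 0" using m by (simp add: t_def)
      have tilt: "tilt m = sqrt (ln (real m)) * t" by (simp add: tilt_def t_def)
      have tsq: "t\<^sup>2 * real m powr (1 - r - 2 * drift) = 1"
      proof -
        let ?s = "1 - r - 2 * drift"
        have "t\<^sup>2 * real m powr ?s = real m powr (- (?s / 2) + - (?s / 2) + ?s)"
          by (simp only: t_def power2_eq_square powr_add)
        also have "- (?s / 2) + - (?s / 2) + ?s = 0" by simp
        finally show ?thesis using m by simp
      qed
      have "(\<Sum>k=1..<m. (tilt m / growth drift (k + 1))\<^sup>2 * num_moves k \<omega> / real k) \<le>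
          (\<Sum>k=1..<m. (tilt m)\<^sup>2 * real K * (growth (1 - r) k / (real k * (growth drift (k + 1))\<^sup>2)))"
      proof (rule sum_mono)
        fix k assume "k \<in> {1..<m}"
        then have k: "k \<ge> 1" by simp
        have "(tilt m / growth drift (k + 1))\<^sup>2 * num_moves k \<omega> / real k \<le>
            (tilt m / growth drift (k + 1))\<^sup>2 * (real K * growth (1 - r) k) / real k"
          using K[OF k] by (intro divide_right_mono mult_left_mono) auto
        also have "\<dots> = (tilt m)\<^sup>2 * real K * (growth (1 - r) k / (real k * (growth drift (k + 1))\<^sup>2))"
          by (simp add: power_divide mult_ac)
        finally show "(tilt m / growth drift (k + 1))\<^sup>2 * num_moves k \<omega> / real k \<le>
            (tilt m)\<^sup>2 * real K * (growth (1 - r) k / (real k * (growth drift (k + 1))\<^sup>2))" .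
      qed
      also have "\<dots> = (tilt m)\<^sup>2 * real K * (\<Sum>k=1..<m. growth (1 - r) k / (real k * (growth drift (k + 1))\<^sup>2))"
        by (simp only: sum_distrib_left)
      also have "\<dots> \<le> (tilt m)\<^sup>2 * real K * (Cv * real m powr (1 - r - 2 * drift))"
        by (intro mult_left_mono Cv(2) m) auto
      also have "\<dots> = real K * Cv * ln (real m) * (t\<^sup>2 * real m powr (1 - r - 2 * drift))"
        using ln_pos by (simp add: tilt power_mult_distrib)
      also have "\<dots> = real K * Cv * ln (real m)" by (simp only: tsq mult_1_right)
      finally have "tilt m / growth drift m * (w \<bullet> position m \<omega>) \<le> B * ln (real m)"
        using elim(1) by (simp add: B_def algebra_simps)
      then have "sqrt (ln (real m)) * (t * (w \<bullet> position m \<omega>)) \<le> B * ln (real m) * growth drift m"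
        using growth_drift_pos[of m] by (simp add: tilt field_simps)
      also have "\<dots> = sqrt (ln (real m)) * (B * sqrt (ln (real m)) * growth drift m)"
        using ln_pos by (simp add: mult_ac)
      finally have "t * (w \<bullet> position m \<omega>) \<le> B * sqrt (ln (real m)) * growth drift m"
        using ln_pos by (simp only: mult_le_cancel_left_pos real_sqrt_gt_0_iff)
      also have "\<dots> \<le> B * sqrt (ln (real m)) * (Cd * real m powr drift)"
        using B ln_pos by (intro mult_left_mono Cd(2) m) auto
      also have "real m powr drift = t * real m powr ((1 - r) / 2)"
        by (simp add: t_def powr_add[symmetric] diff_divide_distrib)
      finally have "t * (w \<bullet> position m \<omega>) \<le> t * (B * Cd * (sqrt (ln (real m)) * real m powr ((1 - r) / 2)))"
        by (simp add: mult_ac)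
      then show ?case using t by (simp only: mult_le_cancel_left_pos)
    qed
    then show ?case using B Cd(1) by (intro exI[of _ "B * Cd"]) auto
  qed
qed

lemma AE_position_coordinate_bound:
  assumes drift: "2 * drift < 1 - r"
  shows "AE \<omega> in M. \<exists>C. \<forall>\<^sub>F m in sequentially. (position m \<omega> $ i)\<^sup>2 \<le> C * (ln (real m) * real m powr (1 - r))"
proof -
  have "norm (axis i 1 :: real^'n::_) = 1" "norm (- axis i 1 :: real^'n::_) = 1" by simp_all
  note bounds = this[THEN AE_position_directional_bound[OF drift]]
  from bounds(1) bounds(2) show ?thesis
  proof eventually_elim
    case (elim \<omega>)
    let ?b = "\<lambda>m. sqrt (ln (real m)) * real m powr ((1 - r) / 2)"
    obtain C C' where C: "C \<ge> 0" "\<forall>\<^sub>F m in sequentially. axis i 1 \<bullet> position m \<omega> \<le> C * ?b m"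
        "C' \<ge> 0" "\<forall>\<^sub>F m in sequentially. - axis i 1 \<bullet> position m \<omega> \<le> C' * ?b m"
      using elim by blast
    have "\<forall>\<^sub>F m in sequentially. (position m \<omega> $ i)\<^sup>2 \<le> (C + C')\<^sup>2 * (ln (real m) * real m powr (1 - r))"
      using C(2,4) eventually_ge_at_top[of 1]
    proof eventually_elim
      case (elim m)
      have b: "?b m \<ge> 0" using elim(3) by simp
      have "C * ?b m \<le> (C + C') * ?b m" "C' * ?b m \<le> (C + C') * ?b m"
        using C(1,3) b by (auto intro!: mult_right_mono)
      then have "\<bar>position m \<omega> $ i\<bar> \<le> (C + C') * ?b m"
        using elim(1,2) by (simp add: inner_axis' abs_le_iff)
      then have "(position m \<omega> $ i)\<^sup>2 \<le> ((C + C') * ?b m)\<^sup>2"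
        using power_mono[of "\<bar>position m \<omega> $ i\<bar>" "(C + C') * ?b m" 2] by simp
      also have "\<dots> = (C + C')\<^sup>2 * (ln (real m) * real m powr (1 - r))"
        using elim(3) by (simp add: power_mult_distrib power2_eq_square[of "_ powr _"] powr_add[symmetric])
      finally show ?case .
    qed
    then show ?case by blast
  qed
qed

lemma AE_S_bigo:
  assumes drift: "2 * drift < 1 - r"
  shows "AE \<omega> in M. (\<lambda>n. (norm (S n \<omega>))\<^sup>2 / (real n)\<^sup>2) \<in> O(\<lambda>n. ln (real n) / real n powr (1 + r))"
proof -
  have "AE \<omega> in M. \<forall>i\<in>UNIV. \<exists>C. \<forall>\<^sub>F m in sequentially. (position m \<omega> $ i)\<^sup>2 \<le> C * (ln (real m) * real m powr (1 - r))"
    by (intro AE_finite_allI finite AE_position_coordinate_bound[OF drift])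
  then show ?thesis
    using AE_space
  proof eventually_elim
    case (elim \<omega>)
    then obtain C where C: "\<forall>i\<in>UNIV. \<forall>\<^sub>F m in sequentially. (position m \<omega> $ i)\<^sup>2 \<le> C i * (ln (real m) * real m powr (1 - r))"
      using bchoice[OF elim(1)] by blast
    have "\<forall>\<^sub>F m in sequentially. \<forall>i. (position m \<omega> $ i)\<^sup>2 \<le> C i * (ln (real m) * real m powr (1 - r))"
      using C by (intro eventually_all_finite) (simp only: ball_UNIV)
    then have "\<forall>\<^sub>F m in sequentially. norm ((norm (S m \<omega>))\<^sup>2 / (real m)\<^sup>2) \<le>
        (\<Sum>i\<in>UNIV. C i) * norm (ln (real m) / real m powr (1 + r))"
      using eventually_ge_at_top[of 1]
    proof eventually_elim
      case (elim m)
      have "(norm (S m \<omega>))\<^sup>2 = (\<Sum>i\<in>UNIV. (position m \<omega> $ i)\<^sup>2)"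
        using S_eq_position[OF elim(2) \<open>\<omega> \<in> space M\<close>] by (simp add: norm_vec_def L2_set_def sum_nonneg)
      also have "\<dots> \<le> (\<Sum>i\<in>UNIV. C i * (ln (real m) * real m powr (1 - r)))"
        using elim(1) by (intro sum_mono) auto
      also have "\<dots> = (\<Sum>i\<in>UNIV. C i) * (ln (real m) * real m powr (1 - r))"
        by (simp only: sum_distrib_right)
      finally have "(norm (S m \<omega>))\<^sup>2 / (real m)\<^sup>2 \<le> (\<Sum>i\<in>UNIV. C i) * (ln (real m) * real m powr (1 - r)) / (real m)\<^sup>2"
        by (rule divide_right_mono) simp
      also have "\<dots> = (\<Sum>i\<in>UNIV. C i) * (ln (real m) / real m powr (1 + r))"
      proof -
        have "real m powr (1 - r) * real m powr (1 + r) = (real m)\<^sup>2"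
          using elim(2) by (simp add: powr_add[symmetric])
        then have "real m powr (1 - r) / (real m)\<^sup>2 = 1 / real m powr (1 + r)"
          using elim(2) by (simp add: frac_eq_eq)
        then show ?thesis by (simp only: times_divide_eq_right[symmetric] mult.assoc) simp
      qed
      finally show ?case using elim(2) by simp
    qed
    then show ?case by (rule bigoI)
  qed
qed

end

theorem theorem3p1:
  fixes M :: "'a measure"
    and p q r :: real
    and A :: "nat \<Rightarrow> 'a \<Rightarrow> real^'n::{finite,linorder}^'n::_"
    and U :: "nat \<Rightarrow> 'a \<Rightarrow> nat"
    and X S :: "nat \<Rightarrow> 'a \<Rightarrow> real^'n::_"
  assumes "merws M p q r A U X S"
    and "p < merws_threshold CARD('n) r"
  shows "(AE \<omega> in M. (\<lambda>n. (1 / real n) *\<^sub>R S n \<omega>) \<longlonglongrightarrow> 0) \<and>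
    (AE \<omega> in M. (\<lambda>n. (norm (S n \<omega>))\<^sup>2 / (real n)\<^sup>2) \<in> O(\<lambda>n. ln (real n) / real n powr (1 + r)))"
proof -
  interpret merws M p q r A U X S by (rule assms(1))
  have bigo: "AE \<omega> in M. (\<lambda>n. (norm (S n \<omega>))\<^sup>2 / (real n)\<^sup>2) \<in> O(\<lambda>n. ln (real n) / real n powr (1 + r))"
    by (rule AE_S_bigo[OF drift_less[OF assms(2)]])
  then have "AE \<omega> in M. (\<lambda>n. (1 / real n) *\<^sub>R S n \<omega>) \<longlonglongrightarrow> 0"
  proof eventually_elim
    case (elim \<omega>)
    have "(\<lambda>n. ln (real n) / real n powr (1 + r)) \<longlonglongrightarrow> 0"
      using r_range by (intro ln_over_powr_tendsto_0) simp
    then have lim: "(\<lambda>n. c * norm (ln (real n) / real n powr (1 + r))) \<longlonglongrightarrow> 0" for c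
      by (intro tendsto_mult_right_zero tendsto_norm_zero)
    obtain c where c: "\<forall>\<^sub>F n in sequentially.
        norm ((norm (S n \<omega>))\<^sup>2 / (real n)\<^sup>2) \<le> c * norm (ln (real n) / real n powr (1 + r))"
      by (rule landau_o.bigE[OF elim]) (rule that)
    have "(\<lambda>n. (norm (S n \<omega>))\<^sup>2 / (real n)\<^sup>2) \<longlonglongrightarrow> 0"
      by (rule Lim_null_comparison[OF c lim])
    then have "(\<lambda>n. sqrt ((norm (S n \<omega>))\<^sup>2 / (real n)\<^sup>2)) \<longlonglongrightarrow> sqrt 0"
      by (rule tendsto_real_sqrt)
    then have "(\<lambda>n. norm ((1 / real n) *\<^sub>R S n \<omega>)) \<longlonglongrightarrow> 0"
      by (simp add: real_sqrt_divide)
    then show ?case by (rule tendsto_norm_zero_cancel)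
  qed
  with bigo show ?thesis by blast
qed

end
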